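(* Let $(X_{i,n})_{n\ge 1,\,1\le i\le [nt]}$ ($t>0$) be a triangular array of row-wise stationary Gaussian variables with mean $0$ and variance $1$ which is non-degenerate, and let $r_n(j)=\operatorname{cor}(X_{1,n},X_{1+j,n})$, $j\ge 0$. Let $k\ge 1$ and $p_1,\dots,p_k\ge 0$, and let $$V(p_1,\dots,p_k)^n_t=\frac1n\sum_{i=1}^{[nt]-k+1}\prod_{j=1}^k|X_{i+j-1,n}|^{p_j}.$$ Assume that there exists a sequence $\mathrm r(j)$ (not depending on $n$) with $$r_n^2(j)\le \mathrm r(j)\quad\text{for all } j,n\ge 1,\qquad \frac1n\sum_{j=1}^{n-1}\mathrm r(j)\to 0\quad\text{as } n\to\infty.$$ Then $$V(p_1,\dots,p_k)^n_t-\rho^{(n)}_{p_1,\dots,p_k}\,t\ \xrightarrow{\ \mathrm{ucp}\ }\ 0,\qquad\text{where } \rho^{(n)}_{p_1,\dots,p_k}=E\big[|X_{1,n}|^{p_1}\cdots|X_{k,n}|^{p_k}\big].$$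
   Context: For each $n$ the row $(X_{i,n})_{i\ge1}$ is a centered stationary Gaussian sequence with unit variance ($t>0$ is arbitrary, so all indices $i\ge 1$ are used). The array is called non-degenerate if the covariance matrix of $(X_{i,n},\dots,X_{i+l,n})$ is invertible for all $l\ge1$ and $n\ge 1$. $[x]$ denotes the integer part of $x$; empty sums are $0$. For processes indexed by $t\ge 0$, $Z^n\xrightarrow{\mathrm{ucp}}Z$ means $\sup_{t\in[0,T]}|Z^n_t-Z_t|\to 0$ in probability for every $T>0$. *)

theory Defs
  imports "HOL-Probability.Probability" "Jordan_Normal_Form.Matrix"
begin

definition cov :: "'a measure \<Rightarrow> ('a \<Rightarrow> real) \<Rightarrow> ('a \<Rightarrow> real) \<Rightarrow> real" where
  "cov M Y Z = (\<integral>\<omega>. (Y \<omega> - (\<integral>\<eta>. Y \<eta> \<partial>M)) * (Z \<omega> - (\<integral>\<eta>. Z \<eta> \<partial>M)) \<partial>M)"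

definition cor :: "'a measure \<Rightarrow> ('a \<Rightarrow> real) \<Rightarrow> ('a \<Rightarrow> real) \<Rightarrow> real" where
  "cor M Y Z = cov M Y Z / sqrt (cov M Y Y * cov M Z Z)"

(* The second disjunct is the degenerate normal law, which normal_density (requiring
   a positive standard deviation) does not cover. *)
definition gaussian_rv :: "'a measure \<Rightarrow> ('a \<Rightarrow> real) \<Rightarrow> bool" where
  "gaussian_rv M Y \<longleftrightarrow>
     Y \<in> borel_measurable M \<and>
     ((\<exists>\<mu> \<sigma>. \<sigma> > 0 \<and> distributed M lborel Y (normal_density \<mu> \<sigma>)) \<or>
      (\<exists>c. AE \<omega> in M. Y \<omega> = c))"

definition gaussian_process :: "'a measure \<Rightarrow> nat set \<Rightarrow> (nat \<Rightarrow> 'a \<Rightarrow> real) \<Rightarrow> bool" where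
  "gaussian_process M I Y \<longleftrightarrow>
     (\<forall>J a. finite J \<and> J \<subseteq> I \<longrightarrow> gaussian_rv M (\<lambda>\<omega>. \<Sum>i\<in>J. a i * Y i \<omega>))"

(* Strict stationarity of the sequence Y 1, Y 2, ...; the value Y 0 is ignored. *)
definition stationary :: "'a measure \<Rightarrow> (nat \<Rightarrow> 'a \<Rightarrow> real) \<Rightarrow> bool" where
  "stationary M Y \<longleftrightarrow>
     (\<forall>J h. finite J \<and> J \<subseteq> {1..} \<longrightarrow>
        distr M (PiM J (\<lambda>_. borel)) (\<lambda>\<omega>. \<lambda>i\<in>J. Y (i + h) \<omega>) =
        distr M (PiM J (\<lambda>_. borel)) (\<lambda>\<omega>. \<lambda>i\<in>J. Y i \<omega>))"

(* X n i is the i-th entry of row n; rows and entries are counted from 1. *)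
definition nondegenerate :: "'a measure \<Rightarrow> (nat \<Rightarrow> nat \<Rightarrow> 'a \<Rightarrow> real) \<Rightarrow> bool" where
  "nondegenerate M X \<longleftrightarrow>
     (\<forall>n\<ge>1. \<forall>i\<ge>1. \<forall>l\<ge>1. invertible_mat
        (Matrix.mat (l + 1) (l + 1) (\<lambda>(a, b). cov M (X n (i + a)) (X n (i + b)))))"

(* Since 0 powr 0 = 0, the convention that the zeroth power is 1 needs its own case. *)
definition abs_power :: "real \<Rightarrow> real \<Rightarrow> real" where
  "abs_power x p = (if p = 0 then 1 else \<bar>x\<bar> powr p)"

(* The upper limit [nt] - k + 1 is written with truncated subtraction as [nt] + 1 - k,
   so that the sum is empty exactly when [nt] < k. *)
definition multipower_variation ::
    "(nat \<Rightarrow> nat \<Rightarrow> 'a \<Rightarrow> real) \<Rightarrow> nat \<Rightarrow> (nat \<Rightarrow> real) \<Rightarrow> nat \<Rightarrow> real \<Rightarrow> 'a \<Rightarrow> real" where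
  "multipower_variation X k p n t \<omega> =
     1 / real n * (\<Sum>i = 1..nat \<lfloor>real n * t\<rfloor> + 1 - k.
        \<Prod>j = 1..k. abs_power (X n (i + j - 1) \<omega>) (p j))"

definition rho ::
    "'a measure \<Rightarrow> (nat \<Rightarrow> nat \<Rightarrow> 'a \<Rightarrow> real) \<Rightarrow> nat \<Rightarrow> (nat \<Rightarrow> real) \<Rightarrow> nat \<Rightarrow> real" where
  "rho M X k p n = (\<integral>\<omega>. (\<Prod>j = 1..k. abs_power (X n j \<omega>) (p j)) \<partial>M)"

(* The supremum is taken in ennreal, where it always exists. Its measurability is part of
   the notion, since measure M is 0 on non-measurable sets. Sequences start at n = 1. *)
definition ucp_tendsto ::
    "'a measure \<Rightarrow> (nat \<Rightarrow> real \<Rightarrow> 'a \<Rightarrow> real) \<Rightarrow> (real \<Rightarrow> 'a \<Rightarrow> real) \<Rightarrow> bool" where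
  "ucp_tendsto M Z Z' \<longleftrightarrow>
     (\<forall>T>0.
        (\<forall>n\<ge>1. (\<lambda>\<omega>. SUP t\<in>{0..T}. ennreal \<bar>Z n t \<omega> - Z' t \<omega>\<bar>) \<in> borel_measurable M) \<and>
        (\<forall>\<epsilon>>0. (\<lambda>n. measure M {\<omega>\<in>space M.
            (SUP t\<in>{0..T}. ennreal \<bar>Z n t \<omega> - Z' t \<omega>\<bar>) > ennreal \<epsilon>}) \<longlonglongrightarrow> 0))"

end

theory Submission
  imports Defs
begin

text \<open>
  Write \<open>G\<close> for the product of the powers \<open>\<bar>y\<^sub>j\<bar>\<close> to the \<open>p\<^sub>j\<close>, so that \<open>V\<close> is the average of \<open>G\<close> over the
  windows \<open>(X\<^sub>i, \<dots>, X\<^sub>i\<^sub>+\<^sub>k\<^sub>-\<^sub>1)\<close> of a row. The core is a weak law of large numbers in the mean, uniform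
  over the number of summands as long as that number is at most a multiple of \<open>n\<close>: the expected
  absolute value of the centred sum is \<open>o(n)\<close>.

  Functions \<open>G\<close> obeying this law form a vector space, closed under approximation in the mean that is
  uniform over all windows. So it suffices to treat a class of functions whose covariances are
  explicit, and cosines of linear forms are such a class. If \<open>Y\<close> and \<open>Z\<close> are jointly Gaussian and
  centred with variances \<open>s\<close> and \<open>t\<close> and covariance \<open>c\<close>, then
  \<open>Cov (cos Y) (cos Z) = exp (-(s + t)/2) * (cosh c - 1)\<close>, and since \<open>\<bar>c\<bar> \<le> (s + t)/2\<close> this is at most
  \<open>c\<^sup>2/2\<close>, with no constant depending on the variances. Hence the variance of a sum of cosines is
  bounded by a sum of squared correlations, which by assumption is \<open>o(n\<^sup>2)\<close>
  (\<open>gaussian_cos_covariance\<close>, \<open>cos_wave_variance\<close>, \<open>weak_law_cos_wave\<close>).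

  Passing from cosines to powers is a one-dimensional matter. An even function on \<open>[-L, L]\<close> is a
  continuous function of \<open>cos (\<pi> x / L)\<close>, hence uniformly close to a polynomial in it
  (\<open>abs_power_cos_approximation\<close>). Outside \<open>[-L, L]\<close> the polynomial stays, up to a small constant, between zero and \<open>\<bar>x\<bar>\<close> to
  the \<open>p\<close>, so the error is \<open>1/L\<close> times a fixed power of \<open>1 + \<bar>x\<bar>\<close>. The products of such polynomials over
  the \<open>k\<close> coordinates are again linear combinations of cosines of linear forms, and they approximate
  \<open>G\<close> with an error whose mean involves only moments of the standard normal law. That makes the approximation
  uniform in \<open>n\<close> even though the joint law of a window changes with \<open>n\<close>.

  Finally, \<open>V\<close> is nondecreasing in \<open>t\<close> and the slopes \<open>\<rho>\<^sup>(\<^sup>n\<^sup>)\<close> are bounded, so convergence at the points of a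
  finite grid gives uniform convergence on bounded intervals (\<open>ucp_tendsto_step_process\<close>).
\<close>

section \<open>Cosines of jointly Gaussian variables\<close>

text \<open>
  The prefactor \<open>exp (- v)\<close> absorbs the growth of \<open>cosh c - 1 \<le> c\<^sup>2/2 * exp \<bar>c\<bar>\<close>, which comes from
  \<open>cosh c - 1 = 2 * (sinh (c / 2))\<^sup>2\<close>.
\<close>

lemma exp_cosh_bound:
  fixes c v :: real
  assumes "\<bar>c\<bar> \<le> v"
  shows "exp (- v) * (cosh c - 1) \<le> c\<^sup>2 / 2"
proof -
  define x where "x = \<bar>c\<bar>"
  have "0 \<le> x" "x \<le> v" "c\<^sup>2 = x\<^sup>2" "cosh c = cosh x"
    using assms by (auto simp: x_def cosh_real_abs)
  have "exp (x / 2) - exp (- (x / 2)) = exp (x / 2) * (1 - exp (- x))"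
    by (simp add: right_diff_distrib exp_add[symmetric])
  also have "\<dots> \<le> exp (x / 2) * x"
    using exp_ge_add_one_self[of "- x"] by (intro mult_left_mono) auto
  finally have "(exp (x / 2) - exp (- (x / 2)))\<^sup>2 \<le> (exp (x / 2) * x)\<^sup>2"
    using \<open>0 \<le> x\<close> by (intro power_mono) auto
  moreover have "(exp (x / 2) - exp (- (x / 2)))\<^sup>2 = 2 * (cosh x - 1)"
    using exp_double[of "x / 2"] exp_double[of "- (x / 2)"]
    by (simp add: power2_diff cosh_field_def mult.assoc mult_exp_exp)
  moreover have "(exp (x / 2) * x)\<^sup>2 = x\<^sup>2 * exp x"
    using exp_double[of "x / 2"] by (simp add: power_mult_distrib)
  ultimately have "cosh x - 1 \<le> x\<^sup>2 / 2 * exp x" by simp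
  also have "\<dots> \<le> x\<^sup>2 / 2 * exp v"
    using \<open>x \<le> v\<close> by (intro mult_left_mono) auto
  finally have "exp (- v) * (cosh x - 1) \<le> exp (- v) * (x\<^sup>2 / 2 * exp v)"
    by (intro mult_left_mono) auto
  then show ?thesis
    unfolding \<open>c\<^sup>2 = x\<^sup>2\<close> \<open>cosh c = cosh x\<close> by (simp add: exp_minus field_simps)
qed

context prob_space
begin

lemma expectation_cos_std_normal:
  assumes "distributed M lborel Z std_normal_density"
  shows "expectation (\<lambda>\<omega>. cos (t * Z \<omega>)) = exp (- t\<^sup>2 / 2)"
proof -
  have meas: "Z \<in> borel_measurable M"
    using distributed_measurable[OF assms] by simp
  have D: "distr M lborel Z = std_normal_distribution"
    using distributed_distr_eq_density[OF assms] by simp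
  interpret N: real_distribution std_normal_distribution
    by (rule real_dist_normal_dist)
  have "complex_integrable std_normal_distribution (\<lambda>x. iexp (t * x))"
    by (rule N.integrable_iexp) auto
  then have "(LINT x|std_normal_distribution. Re (iexp (t * x))) = Re (char std_normal_distribution t)"
    unfolding char_def by (rule integral_Re)
  then have "(LINT x|std_normal_distribution. cos (t * x)) = exp (- t\<^sup>2 / 2)"
    by (simp add: char_std_normal_distribution cis_conv_exp[symmetric] flip: of_real_mult)
  moreover have "(LINT x|distr M lborel Z. cos (t * x)) = expectation (\<lambda>\<omega>. cos (t * Z \<omega>))"
    using meas by (subst integral_distr) auto
  ultimately show ?thesis
    using D by metis
qed

text \<open>
  The two cases of the definition of a Gaussian variable collapse here: a centred constant is zero,
  and the formula for the expected cosine holds for it as well.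
\<close>

lemma gaussian_rv_centred:
  assumes "gaussian_rv M Y" "expectation Y = 0"
  shows "integrable M Y" "integrable M (\<lambda>\<omega>. (Y \<omega>)\<^sup>2)"
    and "expectation (\<lambda>\<omega>. cos (Y \<omega>)) = exp (- expectation (\<lambda>\<omega>. (Y \<omega>)\<^sup>2) / 2)"
proof -
  have meas [measurable]: "Y \<in> borel_measurable M"
    using assms by (simp add: gaussian_rv_def)
  consider (normal) \<mu> \<sigma> where "\<sigma> > 0" "distributed M lborel Y (normal_density \<mu> \<sigma>)"
    | (const) c where "AE \<omega> in M. Y \<omega> = c"
    using assms by (auto simp: gaussian_rv_def)
  then have "integrable M Y \<and> integrable M (\<lambda>\<omega>. (Y \<omega>)\<^sup>2) \<and>
    expectation (\<lambda>\<omega>. cos (Y \<omega>)) = exp (- expectation (\<lambda>\<omega>. (Y \<omega>)\<^sup>2) / 2)"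
  proof cases
    case normal
    have mu: "\<mu> = 0"
      using normal_distributed_expectation[OF normal] assms by simp
    then have D: "distributed M lborel Y (normal_density 0 \<sigma>)"
      using normal by simp
    have var: "expectation (\<lambda>\<omega>. (Y \<omega>)\<^sup>2) = \<sigma>\<^sup>2"
      using normal_distributed_variance[OF normal] assms by simp
    have 1: "integrable M Y"
      using distributed_integrable[OF D, of "\<lambda>x. x"] integrable_normal_moment[of \<sigma> 0 1] normal by simp
    have 2: "integrable M (\<lambda>\<omega>. (Y \<omega>)\<^sup>2)"
      using distributed_integrable[OF D, of "\<lambda>x. x\<^sup>2"] integrable_normal_moment[of \<sigma> 0 2] normal by simp
    have "distributed M lborel (\<lambda>x. (Y x - 0) / \<sigma>) std_normal_density"
      using D unfolding normal_standard_normal_convert[OF normal(1)] .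
    from expectation_cos_std_normal[OF this, of \<sigma>]
    have "expectation (\<lambda>\<omega>. cos (Y \<omega>)) = exp (- \<sigma>\<^sup>2 / 2)"
      using normal by simp
    with 1 2 var show ?thesis by simp
  next
    case const
    have "expectation Y = expectation (\<lambda>_. c)"
      using const by (intro integral_cong_AE) auto
    then have c: "c = 0"
      using assms by (simp add: prob_space)
    have "integrable M Y \<longleftrightarrow> integrable M (\<lambda>_. 0::real)"
      using const c by (intro integrable_cong_AE) auto
    moreover have "integrable M (\<lambda>\<omega>. (Y \<omega>)\<^sup>2) \<longleftrightarrow> integrable M (\<lambda>_. 0::real)"
      using const c by (intro integrable_cong_AE) auto
    moreover have "expectation (\<lambda>\<omega>. (Y \<omega>)\<^sup>2) = expectation (\<lambda>_. 0)"
      using const c by (intro integral_cong_AE) auto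
    moreover have "expectation (\<lambda>\<omega>. cos (Y \<omega>)) = expectation (\<lambda>_. 1)"
      using const c by (intro integral_cong_AE) auto
    ultimately show ?thesis by (simp add: prob_space)
  qed
  then show "integrable M Y" "integrable M (\<lambda>\<omega>. (Y \<omega>)\<^sup>2)"
    "expectation (\<lambda>\<omega>. cos (Y \<omega>)) = exp (- expectation (\<lambda>\<omega>. (Y \<omega>)\<^sup>2) / 2)"
    by auto
qed

lemma integrable_mult_square:
  fixes Y Z :: "'a \<Rightarrow> real"
  assumes "Y \<in> borel_measurable M" "Z \<in> borel_measurable M"
    and "integrable M (\<lambda>\<omega>. (Y \<omega>)\<^sup>2)" "integrable M (\<lambda>\<omega>. (Z \<omega>)\<^sup>2)"
  shows "integrable M (\<lambda>\<omega>. Y \<omega> * Z \<omega>)"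
proof (rule Bochner_Integration.integrable_bound)
  show "integrable M (\<lambda>\<omega>. (Y \<omega>)\<^sup>2 + (Z \<omega>)\<^sup>2)"
    using assms by simp
  have "\<bar>Y \<omega> * Z \<omega>\<bar> \<le> (Y \<omega>)\<^sup>2 + (Z \<omega>)\<^sup>2" for \<omega>
  proof -
    have "0 \<le> \<bar>Y \<omega>\<bar> * \<bar>Z \<omega>\<bar>" by simp
    moreover have "2 * (\<bar>Y \<omega>\<bar> * \<bar>Z \<omega>\<bar>) \<le> (Y \<omega>)\<^sup>2 + (Z \<omega>)\<^sup>2"
      using sum_squares_bound[of "\<bar>Y \<omega>\<bar>" "\<bar>Z \<omega>\<bar>"] by (simp add: mult.assoc)
    ultimately show ?thesis unfolding abs_mult by linarith
  qed
  then show "AE \<omega> in M. norm (Y \<omega> * Z \<omega>) \<le> norm ((Y \<omega>)\<^sup>2 + (Z \<omega>)\<^sup>2)"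
    by (auto intro!: AE_I2 order_trans[OF _ abs_ge_self])
qed (use assms in measurable)

text \<open>
  The product of the cosines is the average of \<open>cos (Y + Z)\<close> and \<open>cos (Y - Z)\<close>. The bound depends on the covariance
  alone and not on the variances of \<open>Y\<close> and \<open>Z\<close>.
\<close>

lemma gaussian_cos_covariance:
  fixes Y Z :: "'a \<Rightarrow> real"
  assumes Y: "gaussian_rv M Y" "expectation Y = 0"
    and Z: "gaussian_rv M Z" "expectation Z = 0"
    and sum: "gaussian_rv M (\<lambda>\<omega>. Y \<omega> + Z \<omega>)"
    and diff: "gaussian_rv M (\<lambda>\<omega>. Y \<omega> - Z \<omega>)"
  shows "expectation (\<lambda>\<omega>. cos (Y \<omega>) * cos (Z \<omega>))
      - expectation (\<lambda>\<omega>. cos (Y \<omega>)) * expectation (\<lambda>\<omega>. cos (Z \<omega>))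
    \<le> (expectation (\<lambda>\<omega>. Y \<omega> * Z \<omega>))\<^sup>2 / 2"
proof -
  have meas [measurable]: "Y \<in> borel_measurable M" "Z \<in> borel_measurable M"
    using Y Z by (auto simp: gaussian_rv_def)
  note YI = gaussian_rv_centred[OF Y] and ZI = gaussian_rv_centred[OF Z]
  have YZ: "integrable M (\<lambda>\<omega>. Y \<omega> * Z \<omega>)"
    using YI ZI by (intro integrable_mult_square) auto
  define s where "s = expectation (\<lambda>\<omega>. (Y \<omega>)\<^sup>2)"
  define t where "t = expectation (\<lambda>\<omega>. (Z \<omega>)\<^sup>2)"
  define c where "c = expectation (\<lambda>\<omega>. Y \<omega> * Z \<omega>)"
  have sq_plus: "expectation (\<lambda>\<omega>. (Y \<omega> + Z \<omega>)\<^sup>2) = s + t + 2 * c"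
    using YI ZI YZ by (simp add: power2_sum s_def t_def c_def mult.assoc)
  have sq_minus: "expectation (\<lambda>\<omega>. (Y \<omega> - Z \<omega>)\<^sup>2) = s + t - 2 * c"
    using YI ZI YZ by (simp add: power2_diff s_def t_def c_def mult.assoc)
  \<comment> \<open>Both second moments are nonnegative, so the covariance is at most the mean variance.\<close>
  have "0 \<le> s + t + 2 * c" "0 \<le> s + t - 2 * c"
    unfolding sq_plus[symmetric] sq_minus[symmetric] by (auto intro!: integral_nonneg)
  then have c_le: "\<bar>c\<bar> \<le> (s + t) / 2" by simp
  have cp: "expectation (\<lambda>\<omega>. cos (Y \<omega> + Z \<omega>)) = exp (- (s + t) / 2 - c)"
    using gaussian_rv_centred(3)[OF sum] YI ZI Y Z sq_plus by (simp add: field_simps)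
  have cm: "expectation (\<lambda>\<omega>. cos (Y \<omega> - Z \<omega>)) = exp (- (s + t) / 2 + c)"
    using gaussian_rv_centred(3)[OF diff] YI ZI Y Z sq_minus by (simp add: field_simps)
  have int_cos: "integrable M (\<lambda>\<omega>. cos (f \<omega>))" if "f \<in> borel_measurable M" for f :: "'a \<Rightarrow> real"
    using that by (intro integrable_const_bound[of _ 1]) auto
  have "expectation (\<lambda>\<omega>. cos (Y \<omega>) * cos (Z \<omega>)) =
      expectation (\<lambda>\<omega>. (cos (Y \<omega> - Z \<omega>) + cos (Y \<omega> + Z \<omega>)) / 2)"
    by (simp add: cos_times_cos)
  also have "\<dots> = (exp (- (s + t) / 2 + c) + exp (- (s + t) / 2 - c)) / 2"
    using int_cos by (simp add: cp cm)
  also have "\<dots> = exp (- ((s + t) / 2)) * cosh c"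
    unfolding minus_divide_left[symmetric] diff_conv_add_uminus exp_add
    by (simp add: cosh_field_def distrib_left)
  finally have "expectation (\<lambda>\<omega>. cos (Y \<omega>) * cos (Z \<omega>)) = exp (- ((s + t) / 2)) * cosh c" .
  moreover have "expectation (\<lambda>\<omega>. cos (Y \<omega>)) * expectation (\<lambda>\<omega>. cos (Z \<omega>)) = exp (- ((s + t) / 2))"
    by (simp add: YI(3) ZI(3) s_def t_def mult_exp_exp add_divide_distrib)
  ultimately show ?thesis
    using exp_cosh_bound[OF c_le] by (simp add: c_def right_diff_distrib)
qed

lemma expectation_abs_le_sqrt:
  fixes Y :: "'a \<Rightarrow> real"
  assumes "Y \<in> borel_measurable M" "integrable M (\<lambda>\<omega>. (Y \<omega>)\<^sup>2)"
  shows "expectation (\<lambda>\<omega>. \<bar>Y \<omega>\<bar>) \<le> sqrt (expectation (\<lambda>\<omega>. (Y \<omega>)\<^sup>2))"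
proof (rule real_le_rsqrt)
  have "integrable M Y"
    using square_integrable_imp_integrable assms by blast
  then have "variance (\<lambda>\<omega>. \<bar>Y \<omega>\<bar>) = expectation (\<lambda>\<omega>. (Y \<omega>)\<^sup>2) - (expectation (\<lambda>\<omega>. \<bar>Y \<omega>\<bar>))\<^sup>2"
    using assms by (subst variance_eq) auto
  then show "(expectation (\<lambda>\<omega>. \<bar>Y \<omega>\<bar>))\<^sup>2 \<le> expectation (\<lambda>\<omega>. (Y \<omega>)\<^sup>2)"
    using variance_positive[of "\<lambda>\<omega>. \<bar>Y \<omega>\<bar>"] by linarith
qed

lemma expectation_square_centred_sum:
  fixes C :: "'i \<Rightarrow> 'a \<Rightarrow> real"
  assumes "finite I"
    and meas: "\<And>i. i \<in> I \<Longrightarrow> C i \<in> borel_measurable M"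
    and bound: "\<And>i \<omega>. i \<in> I \<Longrightarrow> \<bar>C i \<omega>\<bar> \<le> B"
  shows "expectation (\<lambda>\<omega>. (\<Sum>i\<in>I. C i \<omega> - expectation (C i))\<^sup>2) =
    (\<Sum>i\<in>I. \<Sum>l\<in>I. expectation (\<lambda>\<omega>. C i \<omega> * C l \<omega>) - expectation (C i) * expectation (C l))"
proof -
  have int1: "integrable M (C i)" if "i \<in> I" for i
    using meas bound that by (intro integrable_const_bound[of _ B]) auto
  have int2: "integrable M (\<lambda>\<omega>. C i \<omega> * C l \<omega>)" if "i \<in> I" "l \<in> I" for i l
  proof (rule integrable_const_bound[of _ "B * B"])
    have "\<bar>C i \<omega>\<bar> * \<bar>C l \<omega>\<bar> \<le> B * B" for \<omega>
      using bound[of i \<omega>] bound[of l \<omega>] that by (intro mult_mono) auto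
    then show "AE \<omega> in M. norm (C i \<omega> * C l \<omega>) \<le> B * B"
      by (simp add: abs_mult)
  qed (use meas that in \<open>intro borel_measurable_times\<close>)
  have expand: "(C i \<omega> - m) * (C l \<omega> - m') = C i \<omega> * C l \<omega> - m' * C i \<omega> - m * C l \<omega> + m * m'" for i l \<omega> m m'
    by (simp add: algebra_simps)
  have int3: "integrable M (\<lambda>\<omega>. (C i \<omega> - m) * (C l \<omega> - m'))" if "i \<in> I" "l \<in> I" for i l m m'
    unfolding expand using int1 int2 that by simp
  have "expectation (\<lambda>\<omega>. (\<Sum>i\<in>I. C i \<omega> - expectation (C i))\<^sup>2) =
    (\<Sum>i\<in>I. \<Sum>l\<in>I. expectation (\<lambda>\<omega>. (C i \<omega> - expectation (C i)) * (C l \<omega> - expectation (C l))))"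
    unfolding power2_eq_square sum_product
    by (subst Bochner_Integration.integral_sum, fastforce intro: int3)
       (intro sum.cong refl Bochner_Integration.integral_sum int3)
  also have "\<dots> = (\<Sum>i\<in>I. \<Sum>l\<in>I. expectation (\<lambda>\<omega>. C i \<omega> * C l \<omega>) - expectation (C i) * expectation (C l))"
    using int1 int2 unfolding expand by (intro sum.cong refl) (simp add: prob_space)
  finally show ?thesis .
qed

end

text \<open>
  The index map \<open>f\<close> may repeat indices, as happens when two overlapping windows are combined.
  Collecting the coefficients of equal indices brings the sum into the form of the definition.
\<close>

lemma gaussian_process_linear_combination:
  assumes "gaussian_process M I Y" "finite S" "f ` S \<subseteq> I"
  shows "gaussian_rv M (\<lambda>\<omega>. \<Sum>s\<in>S. c s * Y (f s) \<omega>)"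
proof -
  have "(\<Sum>s\<in>S. c s * Y (f s) \<omega>) = (\<Sum>m\<in>f ` S. (\<Sum>s | s \<in> S \<and> f s = m. c s) * Y m \<omega>)" for \<omega>
  proof -
    have "(\<Sum>s\<in>S. c s * Y (f s) \<omega>) = (\<Sum>m\<in>f ` S. \<Sum>s | s \<in> S \<and> f s = m. c s * Y (f s) \<omega>)"
      by (rule sum.image_gen[OF assms(2)])
    also have "\<dots> = (\<Sum>m\<in>f ` S. \<Sum>s | s \<in> S \<and> f s = m. c s * Y m \<omega>)"
      by (intro sum.cong refl) simp
    finally show ?thesis
      by (simp only: sum_distrib_right)
  qed
  then have eq: "(\<lambda>\<omega>. \<Sum>s\<in>S. c s * Y (f s) \<omega>) =
      (\<lambda>\<omega>. \<Sum>m\<in>f ` S. (\<Sum>s | s \<in> S \<and> f s = m. c s) * Y m \<omega>)"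
    by (intro ext)
  have "\<forall>a. gaussian_rv M (\<lambda>\<omega>. \<Sum>m\<in>f ` S. a m * Y m \<omega>)"
    using assms by (auto simp: gaussian_process_def)
  from this[THEN spec, of "\<lambda>m. \<Sum>s | s \<in> S \<and> f s = m. c s"] show ?thesis
    unfolding eq .
qed

section \<open>Approximation of powers by trigonometric polynomials\<close>

lemma abs_power_nonneg: "0 \<le> abs_power x p"
  by (simp add: abs_power_def)

lemma abs_power_abs: "abs_power \<bar>x\<bar> p = abs_power x p"
  by (simp add: abs_power_def)

lemma abs_power_mono:
  assumes "0 \<le> p" "\<bar>x\<bar> \<le> \<bar>y\<bar>"
  shows "abs_power x p \<le> abs_power y p"
  using assms by (auto simp: abs_power_def powr_mono2)

lemma borel_measurable_abs_power [measurable]: "(\<lambda>x. abs_power x p) \<in> borel_measurable borel"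
  unfolding abs_power_def by measurable

lemma continuous_on_abs_power:
  assumes "0 \<le> p"
  shows "continuous_on S (\<lambda>x. abs_power x p)"
proof (cases "p = 0")
  case False
  then have "continuous_on S (\<lambda>x::real. \<bar>x\<bar> powr p)"
    using assms by (intro continuous_on_powr' continuous_intros) auto
  with False show ?thesis by (simp add: abs_power_def)
qed (simp add: abs_power_def)

text \<open>
  A common bound, for all exponents \<open>p \<le> q\<close>, on the powers themselves and, up to the factor \<open>1/L\<close>, on the error of
  their trigonometric approximation at scale \<open>L\<close>. The extra power of \<open>1 + \<bar>x\<bar>\<close> pays for the
  region \<open>\<bar>x\<bar> > L\<close>, where \<open>1 \<le> \<bar>x\<bar> / L\<close>.
\<close>

definition power_envelope :: "nat \<Rightarrow> real \<Rightarrow> real" where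
  "power_envelope q x = 2 * (1 + \<bar>x\<bar>) ^ (q + 1)"

lemma power_envelope_pos: "0 < power_envelope q x"
  by (simp add: power_envelope_def)

lemma abs_power_le_envelope:
  assumes "0 \<le> p" "p \<le> real q"
  shows "(1 + \<bar>x\<bar>) * (1 + abs_power x p) \<le> power_envelope q x" "abs_power x p \<le> power_envelope q x"
proof -
  have "\<bar>x\<bar> powr p \<le> (1 + \<bar>x\<bar>) powr p"
    using assms by (intro powr_mono2) auto
  also have "\<dots> \<le> (1 + \<bar>x\<bar>) powr real q"
    using assms by (intro powr_mono) auto
  also have "\<dots> = (1 + \<bar>x\<bar>) ^ q"
    by (intro powr_realpow) auto
  finally have *: "abs_power x p \<le> (1 + \<bar>x\<bar>) ^ q"
    by (simp add: abs_power_def)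
  have "1 \<le> (1 + \<bar>x\<bar>) ^ q"
    by (rule one_le_power) simp
  with * have "1 + abs_power x p \<le> 2 * (1 + \<bar>x\<bar>) ^ q" by linarith
  then have "(1 + \<bar>x\<bar>) * (1 + abs_power x p) \<le> (1 + \<bar>x\<bar>) * (2 * (1 + \<bar>x\<bar>) ^ q)"
    by (intro mult_left_mono) auto
  then show 1: "(1 + \<bar>x\<bar>) * (1 + abs_power x p) \<le> power_envelope q x"
    by (simp add: power_envelope_def)
  have "abs_power x p \<le> (1 + \<bar>x\<bar>) * (1 + abs_power x p)"
    using abs_power_nonneg[of x p] by (simp add: algebra_simps)
  with 1 show "abs_power x p \<le> power_envelope q x" by linarith
qed

text \<open>
  On \<open>[-L, L]\<close> the number \<open>L / \<pi> * arccos (cos (\<pi> / L * x))\<close> is \<open>\<bar>x\<bar>\<close>, so there the power is a continuous function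
  \<open>f\<close> of \<open>cos (\<pi> / L * x)\<close>, and the Weierstrass theorem supplies the polynomial. For larger \<open>\<bar>x\<bar>\<close> the
  periodic function \<open>f (cos (\<pi> / L * x))\<close> lies between \<open>0\<close> and the power itself.
\<close>

lemma abs_power_cos_approximation:
  assumes p: "0 \<le> p" "p \<le> real q" and L: "1 \<le> L"
  shows "\<exists>g :: real \<Rightarrow> real. real_polynomial_function g \<and>
    (\<forall>x. \<bar>abs_power x p - g (cos (pi / L * x))\<bar> \<le> power_envelope q x / L)"
proof -
  define f where "f u = abs_power (L / pi * arccos u) p" for u
  have "continuous_on {-1..1} f"
    unfolding f_def
    by (rule continuous_on_compose2[OF continuous_on_abs_power[OF p(1), of UNIV]])
       (auto intro!: continuous_intros)
  with L obtain g where g: "real_polynomial_function g"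
    and approx: "\<And>u. u \<in> {-1..1} \<Longrightarrow> \<bar>f u - g u\<bar> < 1 / L"
    using Stone_Weierstrass_real_polynomial_function[of "{-1..1}" f "1 / L"] by auto
  have "\<bar>abs_power x p - g (cos (pi / L * x))\<bar> \<le> power_envelope q x / L" for x
  proof -
    define u where "u = cos (pi / L * x)"
    have near: "\<bar>f u - g u\<bar> \<le> 1 / L"
      using approx[of u] by (simp add: u_def)
    have outer: "\<bar>abs_power x p - f u\<bar> \<le> \<bar>x\<bar> * abs_power x p / L"
    proof (cases "\<bar>x\<bar> \<le> L")
      case True
      then have "\<bar>pi / L * x\<bar> \<le> pi"
        using L by (simp add: abs_mult field_simps)
      then have "L / pi * arccos u = \<bar>x\<bar>"
        using L by (simp add: u_def arccos_cos_eq_abs abs_mult)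
      then have "f u = abs_power x p"
        by (simp add: f_def abs_power_abs)
      then show ?thesis
        using L abs_power_nonneg[of x p] by simp
    next
      case False
      have "0 \<le> arccos u" "arccos u \<le> pi"
        by (auto simp: u_def arccos_lbound arccos_ubound)
      then have "\<bar>L / pi * arccos u\<bar> \<le> L"
        using L by (simp add: abs_mult field_simps)
      then have "f u \<le> abs_power x p"
        using False p unfolding f_def by (intro abs_power_mono) auto
      moreover have "0 \<le> f u"
        by (simp add: f_def abs_power_nonneg)
      moreover have "abs_power x p * 1 \<le> abs_power x p * (\<bar>x\<bar> / L)"
        using False L by (intro mult_left_mono abs_power_nonneg) auto
      ultimately show ?thesis by (simp add: mult.commute)
    qed
    have "1 / L + \<bar>x\<bar> * abs_power x p / L \<le> (1 + \<bar>x\<bar>) * (1 + abs_power x p) / L"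
      using L abs_power_nonneg[of x p]
      by (simp add: add_divide_distrib[symmetric] divide_right_mono algebra_simps)
    also have "\<dots> \<le> power_envelope q x / L"
      using abs_power_le_envelope(1)[OF p] L by (intro divide_right_mono) auto
    finally show ?thesis
      using near outer unfolding u_def by linarith
  qed
  with g show ?thesis by (intro exI[of _ g] conjI allI)
qed

text \<open>
  Each factor is at most the largest one. This reduces the moments of a product of dependent variables
  to moments of the single variables.
\<close>

lemma prod_le_sum_power:
  fixes c :: "'i \<Rightarrow> real"
  assumes "finite I" "I \<noteq> {}" "\<And>i. i \<in> I \<Longrightarrow> 0 \<le> c i"
  shows "(\<Prod>i\<in>I. c i) \<le> (\<Sum>i\<in>I. c i ^ card I)"
proof -
  define m where "m = Max (c ` I)"
  have "m \<in> c ` I"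
    unfolding m_def using assms by (intro Max_in) auto
  then obtain i0 where i0: "i0 \<in> I" "m = c i0" by auto
  have "(\<Prod>i\<in>I. c i) \<le> (\<Prod>i\<in>I. m)"
    using assms by (intro prod_mono) (auto simp: m_def)
  also have "\<dots> = c i0 ^ card I"
    using i0 by simp
  also have "\<dots> \<le> (\<Sum>i\<in>I. c i ^ card I)"
    using assms i0 by (intro member_le_sum) auto
  finally show ?thesis .
qed

text \<open>
  After division by \<open>2 * b i\<close> all factors have absolute value at most one, and then the difference of two
  products is at most the sum of the differences of their factors.
\<close>

lemma prod_diff_le_envelope:
  fixes g h b :: "'i \<Rightarrow> real"
  assumes I: "finite I" "I \<noteq> {}" and L: "1 \<le> L"
    and b: "\<And>i. i \<in> I \<Longrightarrow> 0 < b i"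
    and g: "\<And>i. i \<in> I \<Longrightarrow> \<bar>g i\<bar> \<le> b i"
    and gh: "\<And>i. i \<in> I \<Longrightarrow> \<bar>g i - h i\<bar> \<le> b i / L"
  shows "\<bar>(\<Prod>i\<in>I. g i) - (\<Prod>i\<in>I. h i)\<bar> \<le> card I / L * (\<Sum>i\<in>I. (2 * b i) ^ card I)"
proof -
  have le: "b i / L \<le> b i" if "i \<in> I" for i
    using b[OF that] L by (simp add: field_simps)
  have P: "0 < (\<Prod>i\<in>I. 2 * b i)"
    using b by (intro prod_pos) auto
  have "norm ((\<Prod>i\<in>I. g i / (2 * b i)) - (\<Prod>i\<in>I. h i / (2 * b i)))
      \<le> (\<Sum>i\<in>I. norm (g i / (2 * b i) - h i / (2 * b i)))"
  proof (rule norm_prod_diff)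
    fix i assume i: "i \<in> I"
    show "norm (g i / (2 * b i)) \<le> 1"
      using g[OF i] b[OF i] by simp
    have "\<bar>h i\<bar> \<le> 2 * b i"
      using g[OF i] gh[OF i] le[OF i] by linarith
    then show "norm (h i / (2 * b i)) \<le> 1"
      using b[OF i] by simp
  qed
  also have "\<dots> \<le> (\<Sum>i\<in>I. 1 / L)"
  proof (rule sum_mono)
    fix i assume i: "i \<in> I"
    have "norm (g i / (2 * b i) - h i / (2 * b i)) = \<bar>g i - h i\<bar> / (2 * b i)"
      using b[OF i] by (simp add: diff_divide_distrib[symmetric])
    also have "\<dots> \<le> (b i / L) / (2 * b i)"
      using b[OF i] gh[OF i] by (intro divide_right_mono) auto
    also have "\<dots> \<le> 1 / L"
      using b[OF i] L by (simp add: field_simps)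
    finally show "norm (g i / (2 * b i) - h i / (2 * b i)) \<le> 1 / L" .
  qed
  also have "\<dots> = card I / L" by simp
  finally have "\<bar>(\<Prod>i\<in>I. g i) / (\<Prod>i\<in>I. 2 * b i) - (\<Prod>i\<in>I. h i) / (\<Prod>i\<in>I. 2 * b i)\<bar> \<le> card I / L"
    by (simp add: prod_dividef)
  then have "\<bar>(\<Prod>i\<in>I. g i) - (\<Prod>i\<in>I. h i)\<bar> \<le> card I / L * (\<Prod>i\<in>I. 2 * b i)"
    using P by (simp add: diff_divide_distrib[symmetric] pos_divide_le_eq)
  also have "\<dots> \<le> card I / L * (\<Sum>i\<in>I. (2 * b i) ^ card I)"
    using I b L by (intro mult_left_mono prod_le_sum_power) (auto simp: less_imp_le)
  finally show ?thesis .
qed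

text \<open>
  Trigonometric polynomials in the coordinates \<open>1, \<dots>, k\<close>: the linear span of cosines of linear
  forms. The addition theorem makes it an algebra, and this is what allows products
  over the coordinates.
\<close>

inductive cos_span :: "nat \<Rightarrow> ((nat \<Rightarrow> real) \<Rightarrow> real) \<Rightarrow> bool" for k where
  wave: "cos_span k (\<lambda>y. cos (\<Sum>j = 1..k. a j * y j))"
| add: "cos_span k F \<Longrightarrow> cos_span k G \<Longrightarrow> cos_span k (\<lambda>y. F y + G y)"
| scale: "cos_span k F \<Longrightarrow> cos_span k (\<lambda>y. c * F y)"

lemma cos_span_const: "cos_span k (\<lambda>_. c)"
  using cos_span.scale[OF cos_span.wave[of k "\<lambda>_. 0"], of c] by simp

lemma cos_span_coordinate:
  assumes "j \<in> {1..k}"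
  shows "cos_span k (\<lambda>y. cos (b * y j))"
proof -
  have "(\<Sum>i = 1..k. (if i = j then b else 0) * y i) = b * y j" for y
    using assms by (simp add: if_distrib[of "\<lambda>x. x * _"] sum.delta cong: if_cong)
  then show ?thesis
    using cos_span.wave[of k "\<lambda>i. if i = j then b else 0"] by simp
qed

lemma cos_span_wave_mult:
  assumes "cos_span k F"
  shows "cos_span k (\<lambda>y. cos (\<Sum>j = 1..k. a j * y j) * F y)"
  using assms
proof induction
  case (wave b)
  have eq: "cos (\<Sum>j = 1..k. a j * y j) * cos (\<Sum>j = 1..k. b j * y j) =
     1 / 2 * (cos (\<Sum>j = 1..k. (a j - b j) * y j) + cos (\<Sum>j = 1..k. (a j + b j) * y j))" for y
    by (simp add: cos_times_cos left_diff_distrib distrib_right sum_subtractf sum.distrib)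
  show ?case
    unfolding eq by (intro cos_span.intros)
next
  case (add F G)
  then show ?case
    by (simp add: distrib_left cos_span.add)
next
  case (scale F c)
  then have "cos_span k (\<lambda>y. c * (cos (\<Sum>j = 1..k. a j * y j) * F y))"
    by (intro cos_span.scale)
  then show ?case
    by (simp add: mult.left_commute)
qed

lemma cos_span_mult:
  assumes "cos_span k F" "cos_span k G"
  shows "cos_span k (\<lambda>y. F y * G y)"
  using assms
proof (induction)
  case (add F1 F2)
  then show ?case
    by (simp add: distrib_right cos_span.add)
next
  case (scale F c)
  then have "cos_span k (\<lambda>y. c * (F y * G y))"
    by (intro cos_span.scale)
  then show ?case
    by (simp add: mult.assoc)
qed (rule cos_span_wave_mult)

lemma cos_span_polynomial:
  fixes g :: "real \<Rightarrow> real"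
  assumes "real_polynomial_function g" "cos_span k F"
  shows "cos_span k (\<lambda>y. g (F y))"
  using assms(1)
proof induction
  case (linear f)
  have "f x = f 1 * x" for x
    using linear_scale[OF bounded_linear.linear[OF linear], of x 1] by simp
  then have "(\<lambda>y. f (F y)) = (\<lambda>y. f 1 * F y)" by blast
  then show ?case
    using cos_span.scale[OF assms(2), of "f 1"] by simp
qed (auto intro: cos_span_const cos_span.add cos_span_mult)

lemma cos_span_prod:
  assumes "\<And>j. j \<in> J \<Longrightarrow> cos_span k (F j)"
  shows "cos_span k (\<lambda>y. \<Prod>j\<in>J. F j y)"
  using assms
  by (induction J rule: infinite_finite_induct) (auto intro: cos_span_const cos_span_mult)

lemma exponents_bounded:
  fixes p :: "nat \<Rightarrow> real"
  shows "\<exists>q :: nat. \<forall>j\<in>{1..k}. p j \<le> real q"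
proof (intro exI ballI)
  fix j assume "j \<in> {1..k}"
  then have "p j \<le> Max (p ` {1..k})" by simp
  also have "\<dots> \<le> real (nat \<lceil>Max (p ` {1..k})\<rceil>)" by linarith
  finally show "p j \<le> real (nat \<lceil>Max (p ` {1..k})\<rceil>)" .
qed

section \<open>Arrays with decaying correlations\<close>

text \<open>
  The second-order description of the array on which the weak law rests. For stationary rows the
  covariance depends on the lag alone, and \<open>decay\<close> is the bound on the squared correlations.
\<close>

locale gaussian_array = prob_space M for M :: "'a measure" +
  fixes X :: "nat \<Rightarrow> nat \<Rightarrow> 'a \<Rightarrow> real" and r :: "nat \<Rightarrow> real"
  assumes gaussian: "n \<ge> 1 \<Longrightarrow> gaussian_process M {1..} (X n)"
    and centred: "n \<ge> 1 \<Longrightarrow> i \<ge> 1 \<Longrightarrow> expectation (X n i) = 0"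
    and unit_variance: "n \<ge> 1 \<Longrightarrow> i \<ge> 1 \<Longrightarrow> expectation (\<lambda>\<omega>. (X n i \<omega>)\<^sup>2) = 1"
    and decay: "n \<ge> 1 \<Longrightarrow> 1 \<le> a \<Longrightarrow> a < b \<Longrightarrow>
      (expectation (\<lambda>\<omega>. X n a \<omega> * X n b \<omega>))\<^sup>2 \<le> r (b - a)"
    and vanishing: "(\<lambda>n. 1 / real n * (\<Sum>j = 1..n - 1. r j)) \<longlonglongrightarrow> 0"
begin

abbreviation covariance :: "nat \<Rightarrow> nat \<Rightarrow> nat \<Rightarrow> real" where
  "covariance n a b \<equiv> expectation (\<lambda>\<omega>. X n a \<omega> * X n b \<omega>)"

lemma gaussian_entry:
  assumes "n \<ge> 1" "i \<ge> 1"
  shows "gaussian_rv M (X n i)"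
  using gaussian_process_linear_combination[OF gaussian[OF assms(1)], of "{i}" "\<lambda>x. x" "\<lambda>_. 1"] assms
  by simp

lemma measurable_entry [measurable]:
  assumes "n \<ge> 1" "i \<ge> 1"
  shows "X n i \<in> borel_measurable M"
  using gaussian_entry[OF assms] by (simp add: gaussian_rv_def)

lemma std_normal_entry:
  assumes "n \<ge> 1" "i \<ge> 1"
  shows "distributed M lborel (X n i) std_normal_density"
proof -
  have "\<not> (AE \<omega> in M. X n i \<omega> = c)" for c
  proof
    assume const: "AE \<omega> in M. X n i \<omega> = c"
    have "expectation (X n i) = expectation (\<lambda>_. c)"
      using const assms by (intro integral_cong_AE) auto
    then have "c = 0"
      using centred[OF assms] by (simp add: prob_space)
    then have "expectation (\<lambda>\<omega>. (X n i \<omega>)\<^sup>2) = expectation (\<lambda>_. 0)"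
      using const assms by (intro integral_cong_AE) auto
    then show False
      using unit_variance[OF assms] by simp
  qed
  then obtain \<mu> \<sigma> where normal: "\<sigma> > 0" "distributed M lborel (X n i) (normal_density \<mu> \<sigma>)"
    using gaussian_entry[OF assms] by (auto simp: gaussian_rv_def)
  have "\<mu> = 0"
    using normal_distributed_expectation[OF normal] centred[OF assms] by simp
  moreover have "\<sigma> = 1"
    using normal_distributed_variance[OF normal] centred[OF assms] unit_variance[OF assms] normal(1)
    by (simp add: power2_eq_1_iff)
  ultimately show ?thesis
    using normal by simp
qed

lemma integrable_entry_square:
  assumes "n \<ge> 1" "i \<ge> 1"
  shows "integrable M (\<lambda>\<omega>. (X n i \<omega>)\<^sup>2)"
  using gaussian_rv_centred(2) gaussian_entry centred assms by blast

lemma integrable_entry_product: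
  assumes "n \<ge> 1" "a \<ge> 1" "b \<ge> 1"
  shows "integrable M (\<lambda>\<omega>. X n a \<omega> * X n b \<omega>)"
  using assms by (intro integrable_mult_square integrable_entry_square measurable_entry)

lemma integrable_entry:
  assumes "n \<ge> 1" "i \<ge> 1"
  shows "integrable M (X n i)"
  using gaussian_rv_centred(1) gaussian_entry centred assms by blast

lemma decay_nonneg: "j \<ge> 1 \<Longrightarrow> 0 \<le> r j"
  using decay[of 1 1 "1 + j"] by (intro order_trans[OF zero_le_power2]) auto

text \<open>
  A row of the covariance matrix meets each positive lag at most twice, once on each side of the diagonal.
\<close>

lemma covariance_row_sum:
  assumes n: "n \<ge> 1" and a: "a \<in> {1..P}"
  shows "(\<Sum>b = 1..P. (covariance n a b)\<^sup>2) \<le> 1 + 2 * (\<Sum>j = 1..P - 1. r j)"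
proof -
  have "(\<Sum>b = 1..P. (covariance n a b)\<^sup>2) =
      (\<Sum>b\<in>{1..<a}. (covariance n a b)\<^sup>2) + (\<Sum>b\<in>{a..P}. (covariance n a b)\<^sup>2)"
    using a by (subst sum.union_disjoint[symmetric]) (auto intro!: sum.cong)
  also have "(\<Sum>b\<in>{a..P}. (covariance n a b)\<^sup>2) =
      (covariance n a a)\<^sup>2 + (\<Sum>b\<in>{a<..P}. (covariance n a b)\<^sup>2)"
    using a by (intro sum.head) auto
  finally have "(\<Sum>b = 1..P. (covariance n a b)\<^sup>2) =
      (\<Sum>b\<in>{1..<a}. (covariance n a b)\<^sup>2) + ((covariance n a a)\<^sup>2 + (\<Sum>b\<in>{a<..P}. (covariance n a b)\<^sup>2))" .
  moreover have "covariance n a a = 1"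
    using unit_variance[OF n, of a] a by (simp add: power2_eq_square)
  moreover have "(\<Sum>b\<in>{a<..P}. (covariance n a b)\<^sup>2) \<le> (\<Sum>j = 1..P - 1. r j)"
  proof -
    have "(\<Sum>b\<in>{a<..P}. (covariance n a b)\<^sup>2) \<le> (\<Sum>b\<in>{a<..P}. r (b - a))"
      using n a by (intro sum_mono decay) auto
    also have "\<dots> = (\<Sum>j\<in>(\<lambda>b. b - a) ` {a<..P}. r j)"
      by (subst sum.reindex) (auto simp: inj_on_def)
    also have "\<dots> \<le> (\<Sum>j = 1..P - 1. r j)"
      using a by (intro sum_mono2 decay_nonneg) auto
    finally show ?thesis .
  qed
  moreover have "(\<Sum>b\<in>{1..<a}. (covariance n a b)\<^sup>2) \<le> (\<Sum>j = 1..P - 1. r j)"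
  proof -
    have "(\<Sum>b\<in>{1..<a}. (covariance n a b)\<^sup>2) \<le> (\<Sum>b\<in>{1..<a}. r (a - b))"
      using n a decay[OF n, of _ a] by (intro sum_mono) (auto simp: mult.commute)
    also have "\<dots> = (\<Sum>j\<in>(\<lambda>b. a - b) ` {1..<a}. r j)"
      by (subst sum.reindex) (auto simp: inj_on_def)
    also have "\<dots> \<le> (\<Sum>j = 1..P - 1. r j)"
      using a by (intro sum_mono2 decay_nonneg) auto
    finally show ?thesis .
  qed
  ultimately show ?thesis by simp
qed

lemma covariance_square_sum:
  assumes "n \<ge> 1"
  shows "(\<Sum>a = 1..P. \<Sum>b = 1..P. (covariance n a b)\<^sup>2) \<le> P * (1 + 2 * (\<Sum>j = 1..P - 1. r j))"
  using sum_bounded_above[of "{1..P}" "\<lambda>a. \<Sum>b = 1..P. (covariance n a b)\<^sup>2", OF covariance_row_sum[OF assms]]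
  by simp

definition window :: "nat \<Rightarrow> nat \<Rightarrow> 'a \<Rightarrow> nat \<Rightarrow> real" where
  "window n i \<omega> = (\<lambda>j. X n (i + j - 1) \<omega>)"

definition fluctuation :: "((nat \<Rightarrow> real) \<Rightarrow> real) \<Rightarrow> nat \<Rightarrow> nat \<Rightarrow> real" where
  "fluctuation F n N = expectation (\<lambda>\<omega>. \<bar>\<Sum>i = 1..N. F (window n i \<omega>) - expectation (\<lambda>\<eta>. F (window n i \<eta>))\<bar>)"

text \<open>
  The number of summands \<open>N n\<close> is an arbitrary sequence of at most linear growth, which covers
  \<open>[nt] - k + 1\<close> for every \<open>t\<close>.
\<close>

definition weak_law :: "((nat \<Rightarrow> real) \<Rightarrow> real) \<Rightarrow> bool" where
  "weak_law F \<longleftrightarrow>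
     (\<forall>n\<ge>1. \<forall>i\<ge>1. integrable M (\<lambda>\<omega>. F (window n i \<omega>))) \<and>
     (\<forall>N c. (\<forall>n. N n \<le> c * n) \<longrightarrow> (\<lambda>n. fluctuation F n (N n) / real n) \<longlonglongrightarrow> 0)"

text \<open>
  By \<open>gaussian_cos_covariance\<close> the left-hand side is at most the sum of the squared covariances of the linear
  forms \<open>\<xi> i\<close>. The Cauchy-Schwarz inequality splits off the coefficients, and for fixed positions \<open>j\<close>, \<open>j'\<close>
  inside the windows the remaining double sum runs over distinct pairs of entries with indices at most \<open>N + k\<close>.
\<close>

lemma cos_wave_variance:
  fixes a :: "nat \<Rightarrow> real" and k :: nat
  assumes n: "n \<ge> 1"
  defines "\<xi> \<equiv> \<lambda>i \<omega>. \<Sum>j = 1..k. a j * window n i \<omega> j"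
  shows "expectation (\<lambda>\<omega>. (\<Sum>i = 1..N. cos (\<xi> i \<omega>) - expectation (\<lambda>\<eta>. cos (\<xi> i \<eta>)))\<^sup>2)
    \<le> (\<Sum>j = 1..k. (a j)\<^sup>2)\<^sup>2 * (real k)\<^sup>2 * (real (N + k) * (1 + 2 * (\<Sum>j = 1..N + k - 1. r j)))"
proof -
  define K where "K = {1..k}"
  have fin: "finite K" by (simp add: K_def)
  have idx: "1 \<le> i + j - 1" if "i \<in> {1..N}" "j \<in> K" for i j
    using that by (auto simp: K_def)
  have xi: "\<xi> i = (\<lambda>\<omega>. \<Sum>j\<in>K. a j * X n (i + j - 1) \<omega>)" for i
    by (simp add: \<xi>_def window_def K_def)
  have gauss: "gaussian_rv M (\<xi> i)" if "i \<in> {1..N}" for i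
    unfolding xi using idx that
    by (intro gaussian_process_linear_combination[OF gaussian[OF n]] fin) auto
  have gauss2: "gaussian_rv M (\<lambda>\<omega>. \<xi> i \<omega> + e * \<xi> l \<omega>)" if "i \<in> {1..N}" "l \<in> {1..N}" for i l e
  proof -
    \<comment> \<open>The disjoint sum keeps the two windows apart even where their indices coincide.\<close>
    have "gaussian_rv M (\<lambda>\<omega>. \<Sum>s\<in>K <+> K. case_sum a (\<lambda>j. e * a j) s *
        X n (case_sum (\<lambda>j. i + j - 1) (\<lambda>j. l + j - 1) s) \<omega>)"
      using idx that by (intro gaussian_process_linear_combination[OF gaussian[OF n]]) (auto simp: fin)
    then show ?thesis
      by (simp add: sum.Plus fin xi sum_distrib_left mult.assoc)
  qed
  have mean: "expectation (\<xi> i) = 0" if "i \<in> {1..N}" for i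
    unfolding xi using idx that n integrable_entry centred
    by (subst Bochner_Integration.integral_sum) auto
  have meas: "\<xi> i \<in> borel_measurable M" if "i \<in> {1..N}" for i
    using gauss[OF that] by (simp add: gaussian_rv_def)
  have cross: "(expectation (\<lambda>\<omega>. \<xi> i \<omega> * \<xi> l \<omega>))\<^sup>2
      \<le> (\<Sum>j\<in>K. (a j)\<^sup>2)\<^sup>2 * (\<Sum>j\<in>K. \<Sum>j'\<in>K. (covariance n (i + j - 1) (l + j' - 1))\<^sup>2)"
    if il: "i \<in> {1..N}" "l \<in> {1..N}" for i l
  proof -
    have "expectation (\<lambda>\<omega>. \<xi> i \<omega> * \<xi> l \<omega>) =
        expectation (\<lambda>\<omega>. \<Sum>j\<in>K. \<Sum>j'\<in>K. (a j * a j') * (X n (i + j - 1) \<omega> * X n (l + j' - 1) \<omega>))"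
      by (simp add: xi sum_product algebra_simps)
    also have "\<dots> = (\<Sum>j\<in>K. \<Sum>j'\<in>K. (a j * a j') * covariance n (i + j - 1) (l + j' - 1))"
      using integrable_entry_product[OF n idx idx] il
      by (simp add: Bochner_Integration.integral_sum)
    also have "\<dots> = (\<Sum>x\<in>K \<times> K. (a (fst x) * a (snd x)) * covariance n (i + fst x - 1) (l + snd x - 1))"
      by (simp add: sum.cartesian_product case_prod_unfold)
    finally have eq: "expectation (\<lambda>\<omega>. \<xi> i \<omega> * \<xi> l \<omega>) =
        (\<Sum>x\<in>K \<times> K. (a (fst x) * a (snd x)) * covariance n (i + fst x - 1) (l + snd x - 1))" .
    have "(expectation (\<lambda>\<omega>. \<xi> i \<omega> * \<xi> l \<omega>))\<^sup>2 \<le>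
        (\<Sum>x\<in>K \<times> K. (a (fst x) * a (snd x))\<^sup>2) *
        (\<Sum>x\<in>K \<times> K. (covariance n (i + fst x - 1) (l + snd x - 1))\<^sup>2)"
      unfolding eq by (rule Cauchy_Schwarz_ineq_sum)
    also have "(\<Sum>x\<in>K \<times> K. (a (fst x) * a (snd x))\<^sup>2) = (\<Sum>j\<in>K. \<Sum>j'\<in>K. (a j)\<^sup>2 * (a j')\<^sup>2)"
      by (simp add: power_mult_distrib sum.cartesian_product case_prod_unfold)
    also have "\<dots> = (\<Sum>j\<in>K. (a j)\<^sup>2)\<^sup>2"
      unfolding power2_eq_square[of "\<Sum>j\<in>K. (a j)\<^sup>2"] by (simp only: sum_product)
    finally show ?thesis
      by (simp add: sum.cartesian_product case_prod_unfold)
  qed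
  have window_sum: "(\<Sum>i = 1..N. \<Sum>l = 1..N. (covariance n (i + j - 1) (l + j' - 1))\<^sup>2)
      \<le> real (N + k) * (1 + 2 * (\<Sum>j = 1..N + k - 1. r j))" if jj: "j \<in> K" "j' \<in> K" for j j'
  proof -
    have "(\<Sum>i = 1..N. \<Sum>l = 1..N. (covariance n (i + j - 1) (l + j' - 1))\<^sup>2)
      = (\<Sum>x\<in>{1..N} \<times> {1..N}. (\<lambda>y. (covariance n (fst y) (snd y))\<^sup>2) (fst x + j - 1, snd x + j' - 1))"
      by (simp add: sum.cartesian_product case_prod_unfold)
    also have "\<dots> = (\<Sum>y\<in>(\<lambda>x. (fst x + j - 1, snd x + j' - 1)) ` ({1..N} \<times> {1..N}).
        (covariance n (fst y) (snd y))\<^sup>2)"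
      by (subst sum.reindex) (auto simp: inj_on_def)
    also have "\<dots> \<le> (\<Sum>y\<in>{1..N + k} \<times> {1..N + k}. (covariance n (fst y) (snd y))\<^sup>2)"
      using jj by (intro sum_mono2) (auto simp: K_def)
    also have "\<dots> = (\<Sum>a = 1..N + k. \<Sum>b = 1..N + k. (covariance n a b)\<^sup>2)"
      by (simp add: sum.cartesian_product case_prod_unfold)
    also have "\<dots> \<le> real (N + k) * (1 + 2 * (\<Sum>j = 1..N + k - 1. r j))"
      by (rule covariance_square_sum[OF n])
    finally show ?thesis .
  qed
  have "expectation (\<lambda>\<omega>. (\<Sum>i = 1..N. cos (\<xi> i \<omega>) - expectation (\<lambda>\<eta>. cos (\<xi> i \<eta>)))\<^sup>2) =
    (\<Sum>i = 1..N. \<Sum>l = 1..N. expectation (\<lambda>\<omega>. cos (\<xi> i \<omega>) * cos (\<xi> l \<omega>))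
      - expectation (\<lambda>\<omega>. cos (\<xi> i \<omega>)) * expectation (\<lambda>\<omega>. cos (\<xi> l \<omega>)))"
    using meas by (intro expectation_square_centred_sum[where B = 1]) auto
  also have "\<dots> \<le> (\<Sum>i = 1..N. \<Sum>l = 1..N.
      (\<Sum>j\<in>K. (a j)\<^sup>2)\<^sup>2 * (\<Sum>j\<in>K. \<Sum>j'\<in>K. (covariance n (i + j - 1) (l + j' - 1))\<^sup>2))"
  proof (intro sum_mono)
    fix i l assume il: "i \<in> {1..N}" "l \<in> {1..N}"
    have "expectation (\<lambda>\<omega>. cos (\<xi> i \<omega>) * cos (\<xi> l \<omega>))
        - expectation (\<lambda>\<omega>. cos (\<xi> i \<omega>)) * expectation (\<lambda>\<omega>. cos (\<xi> l \<omega>))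
      \<le> (expectation (\<lambda>\<omega>. \<xi> i \<omega> * \<xi> l \<omega>))\<^sup>2 / 2"
      using gauss2[OF il, of 1] gauss2[OF il, of "-1"] gauss mean il
      by (intro gaussian_cos_covariance) auto
    also have "\<dots> \<le> (expectation (\<lambda>\<omega>. \<xi> i \<omega> * \<xi> l \<omega>))\<^sup>2" by simp
    also note cross[OF il]
    finally show "expectation (\<lambda>\<omega>. cos (\<xi> i \<omega>) * cos (\<xi> l \<omega>))
        - expectation (\<lambda>\<omega>. cos (\<xi> i \<omega>)) * expectation (\<lambda>\<omega>. cos (\<xi> l \<omega>)) \<le>
      (\<Sum>j\<in>K. (a j)\<^sup>2)\<^sup>2 * (\<Sum>j\<in>K. \<Sum>j'\<in>K. (covariance n (i + j - 1) (l + j' - 1))\<^sup>2)" .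
  qed
  also have "\<dots> = (\<Sum>j\<in>K. (a j)\<^sup>2)\<^sup>2 *
      (\<Sum>j\<in>K. \<Sum>j'\<in>K. \<Sum>i = 1..N. \<Sum>l = 1..N. (covariance n (i + j - 1) (l + j' - 1))\<^sup>2)"
  proof -
    have swap: "(\<Sum>i = 1..N. \<Sum>l = 1..N. \<Sum>j\<in>K. \<Sum>j'\<in>K. f i l j j') =
        (\<Sum>j\<in>K. \<Sum>j'\<in>K. \<Sum>i = 1..N. \<Sum>l = 1..N. f i l j j')" for f :: "nat \<Rightarrow> nat \<Rightarrow> nat \<Rightarrow> nat \<Rightarrow> real"
    proof -
      have "(\<Sum>i = 1..N. \<Sum>l = 1..N. \<Sum>j\<in>K. \<Sum>j'\<in>K. f i l j j') =
          (\<Sum>i = 1..N. \<Sum>j\<in>K. \<Sum>l = 1..N. \<Sum>j'\<in>K. f i l j j')"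
        by (rule sum.cong[OF refl], rule sum.swap)
      also have "\<dots> = (\<Sum>j\<in>K. \<Sum>i = 1..N. \<Sum>l = 1..N. \<Sum>j'\<in>K. f i l j j')"
        by (rule sum.swap)
      also have "\<dots> = (\<Sum>j\<in>K. \<Sum>i = 1..N. \<Sum>j'\<in>K. \<Sum>l = 1..N. f i l j j')"
        by (rule sum.cong[OF refl], rule sum.cong[OF refl], rule sum.swap)
      also have "\<dots> = (\<Sum>j\<in>K. \<Sum>j'\<in>K. \<Sum>i = 1..N. \<Sum>l = 1..N. f i l j j')"
        by (rule sum.cong[OF refl], rule sum.swap)
      finally show ?thesis .
    qed
    show ?thesis
      unfolding sum_distrib_left[symmetric] swap ..
  qed
  also have "\<dots> \<le> (\<Sum>j\<in>K. (a j)\<^sup>2)\<^sup>2 *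
      (\<Sum>j\<in>K. \<Sum>j'\<in>K. real (N + k) * (1 + 2 * (\<Sum>j = 1..N + k - 1. r j)))"
    by (intro mult_left_mono sum_mono window_sum) auto
  also have "\<dots> = (\<Sum>j = 1..k. (a j)\<^sup>2)\<^sup>2 * (real k)\<^sup>2 * (real (N + k) * (1 + 2 * (\<Sum>j = 1..N + k - 1. r j)))"
    by (simp add: K_def power2_eq_square[of "real k"] mult.assoc)
  finally show ?thesis .
qed

section \<open>The weak law for trigonometric polynomials\<close>

lemma fluctuation_nonneg: "0 \<le> fluctuation F n m"
  by (simp add: fluctuation_def)

lemma measurable_window_coordinate:
  assumes "n \<ge> 1" "i \<ge> 1" "j \<ge> 1"
  shows "(\<lambda>\<omega>. window n i \<omega> j) \<in> borel_measurable M"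
  unfolding window_def using assms by (intro measurable_entry) auto

lemma integrable_cos_wave:
  assumes "n \<ge> 1" "i \<ge> 1"
  shows "integrable M (\<lambda>\<omega>. cos (\<Sum>j = 1..k. a j * window n i \<omega> j))"
proof -
  have "(\<lambda>\<omega>. \<Sum>j = 1..k. a j * window n i \<omega> j) \<in> borel_measurable M"
    using assms by (intro borel_measurable_sum borel_measurable_times measurable_window_coordinate) auto
  then show ?thesis
    by (intro integrable_const_bound[of _ 1]) auto
qed

text \<open>
  The mean deviation is at most the standard deviation, and by \<open>cos_wave_variance\<close> the variance divided by
  \<open>n\<^sup>2\<close> is a constant times \<open>1/n\<close> plus the average of \<open>r\<close> over about \<open>K n\<close> lags, for a fixed
  multiple \<open>K\<close>. The latter is a subsequence of the averages that vanish by assumption.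
\<close>

lemma weak_law_cos_wave: "weak_law (\<lambda>y. cos (\<Sum>j = 1..k. a j * y j))"
  unfolding weak_law_def
proof (intro conjI allI impI integrable_cos_wave)
  fix N :: "nat \<Rightarrow> nat" and c :: nat assume N: "\<forall>n. N n \<le> c * n"
  \<comment> \<open>The first \<open>N n\<close> windows use entries with indices at most \<open>N n + k \<le> K * n\<close>.\<close>
  define K where "K = c + k + 1"
  have K_pos: "0 < K" by (simp add: K_def)
  define B where "B = (\<Sum>j = 1..k. (a j)\<^sup>2)\<^sup>2 * (real k)\<^sup>2 * real K"
  have "0 \<le> B" by (simp add: B_def)
  define S where "S m = (\<Sum>j = 1..m - 1. r j)" for m
  have S_mono: "S m \<le> S m'" if "m \<le> m'" for m m'
    unfolding S_def using that by (intro sum_mono2 decay_nonneg) auto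
  have "(\<lambda>n. S (n * K) / real (n * K)) \<longlonglongrightarrow> 0"
    using LIMSEQ_subseq_LIMSEQ[OF vanishing, of "\<lambda>n. n * K"]
    by (simp add: S_def o_def strict_mono_def K_pos)
  then have "(\<lambda>n. real K * (S (n * K) / real (n * K))) \<longlonglongrightarrow> 0"
    by (rule tendsto_mult_right_zero)
  then have S_lim: "(\<lambda>n. S (n * K) / real n) \<longlonglongrightarrow> 0"
    using K_pos by simp
  have "(\<lambda>n. sqrt (B * (1 / real n + 2 * (S (n * K) / real n)))) \<longlonglongrightarrow> sqrt (B * (0 + 2 * 0))"
    by (intro tendsto_intros lim_1_over_n S_lim)
  then have lim: "(\<lambda>n. sqrt (B * (1 / real n + 2 * (S (n * K) / real n)))) \<longlonglongrightarrow> 0" by simp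
  have bound: "fluctuation (\<lambda>y. cos (\<Sum>j = 1..k. a j * y j)) n (N n) / real n
      \<le> sqrt (B * (1 / real n + 2 * (S (n * K) / real n)))" if n: "n \<ge> 1" for n
  proof -
    have int: "integrable M (\<lambda>\<omega>. cos (\<Sum>j = 1..k. a j * window n i \<omega> j))" if "i \<in> {1..N n}" for i
      using n that by (intro integrable_cos_wave) auto
    let ?D = "\<lambda>\<omega>. \<Sum>i = 1..N n. cos (\<Sum>j = 1..k. a j * window n i \<omega> j) -
      expectation (\<lambda>\<eta>. cos (\<Sum>j = 1..k. a j * window n i \<eta> j))"
    have D_meas: "?D \<in> borel_measurable M" using int by (intro borel_measurable_sum borel_measurable_diff) auto
    have prob_abs: "\<bar>expectation (\<lambda>\<eta>. cos (\<Sum>j = 1..k. a j * window n i \<eta> j))\<bar> \<le> 1" if "i \<in> {1..N n}" for i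
    proof -
      have "\<bar>expectation (\<lambda>\<eta>. cos (\<Sum>j = 1..k. a j * window n i \<eta> j))\<bar>
          \<le> expectation (\<lambda>\<eta>. \<bar>cos (\<Sum>j = 1..k. a j * window n i \<eta> j)\<bar>)"
        by (rule integral_abs_bound)
      also have "\<dots> \<le> expectation (\<lambda>\<eta>. 1)"
        by (intro integral_mono integrable_abs int that) auto
      finally show ?thesis by (simp add: prob_space)
    qed
    have "\<bar>?D \<omega>\<bar> \<le> (\<Sum>i = 1..N n. 1 + 1)" for \<omega>
      by (rule order_trans[OF sum_abs])
         (intro sum_mono order_trans[OF abs_triangle_ineq4] add_mono prob_abs abs_cos_le_one)
    then have "(?D \<omega>)\<^sup>2 \<le> (2 * real (N n))\<^sup>2" for \<omega>
      using power_mono[of "\<bar>?D \<omega>\<bar>" "2 * real (N n)" 2] by (simp add: power2_abs mult.commute)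
    then have D2: "integrable M (\<lambda>\<omega>. (?D \<omega>)\<^sup>2)"
      using D_meas by (intro integrable_const_bound[of _ "(2 * real (N n))\<^sup>2"]) auto
    have le: "N n + k \<le> n * K"
    proof -
      have "k * 1 \<le> k * n"
        using n by (intro mult_le_mono2)
      moreover have "n * K = c * n + k * n + n"
        by (simp add: K_def algebra_simps)
      ultimately show ?thesis
        using N[rule_format, of n] by linarith
    qed
    have "fluctuation (\<lambda>y. cos (\<Sum>j = 1..k. a j * y j)) n (N n) \<le> sqrt (expectation (\<lambda>\<omega>. (?D \<omega>)\<^sup>2))"
      unfolding fluctuation_def using D_meas D2 by (rule expectation_abs_le_sqrt)
    also have "\<dots> \<le> sqrt ((\<Sum>j = 1..k. (a j)\<^sup>2)\<^sup>2 * (real k)\<^sup>2 * (real (N n + k) * (1 + 2 * S (N n + k))))"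
      unfolding S_def by (intro real_sqrt_le_mono cos_wave_variance n)
    also have "\<dots> \<le> sqrt ((\<Sum>j = 1..k. (a j)\<^sup>2)\<^sup>2 * (real k)\<^sup>2 * (real (n * K) * (1 + 2 * S (n * K))))"
      using le S_mono[OF le] S_mono[of 0 "N n + k"]
      by (intro real_sqrt_le_mono mult_left_mono mult_mono) (auto simp: S_def simp del: of_nat_add of_nat_mult)
    also have "\<dots> = sqrt (B * (1 / real n + 2 * (S (n * K) / real n)) * (real n)\<^sup>2)"
      using n by (simp add: B_def field_simps power2_eq_square)
    also have "\<dots> = sqrt (B * (1 / real n + 2 * (S (n * K) / real n))) * real n"
      by (simp add: real_sqrt_mult)
    finally show ?thesis
      using n by (simp add: pos_divide_le_eq)
  qed
  show "(\<lambda>n. fluctuation (\<lambda>y. cos (\<Sum>j = 1..k. a j * y j)) n (N n) / real n) \<longlonglongrightarrow> 0"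
  proof (rule tendsto_sandwich[OF _ _ tendsto_const lim])
    show "\<forall>\<^sub>F n in sequentially. fluctuation (\<lambda>y. cos (\<Sum>j = 1..k. a j * y j)) n (N n) / real n
      \<le> sqrt (B * (1 / real n + 2 * (S (n * K) / real n)))"
      by (rule eventually_sequentiallyI[of 1], rule bound)
  qed (simp add: fluctuation_nonneg)
qed

lemma weak_law_integrable:
  "weak_law F \<Longrightarrow> n \<ge> 1 \<Longrightarrow> i \<ge> 1 \<Longrightarrow> integrable M (\<lambda>\<omega>. F (window n i \<omega>))"
  by (simp add: weak_law_def)

lemma weak_law_fluctuation:
  "weak_law F \<Longrightarrow> (\<And>n. N n \<le> c * n) \<Longrightarrow> (\<lambda>n. fluctuation F n (N n) / real n) \<longlonglongrightarrow> 0"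
  unfolding weak_law_def by blast

lemma weak_law_scale:
  assumes F: "weak_law F"
  shows "weak_law (\<lambda>y. c * F y)"
  unfolding weak_law_def
proof (intro conjI allI impI)
  fix n i :: nat assume "1 \<le> n" "1 \<le> i"
  then show "integrable M (\<lambda>\<omega>. c * F (window n i \<omega>))"
    using weak_law_integrable[OF F] by simp
next
  fix N :: "nat \<Rightarrow> nat" and d :: nat assume N: "\<forall>n. N n \<le> d * n"
  have "fluctuation (\<lambda>y. c * F y) n m = \<bar>c\<bar> * fluctuation F n m" for n m
    by (simp add: fluctuation_def right_diff_distrib[symmetric] sum_distrib_left[symmetric] abs_mult)
  moreover have "(\<lambda>n. \<bar>c\<bar> * (fluctuation F n (N n) / real n)) \<longlonglongrightarrow> 0"
    using weak_law_fluctuation[OF F, of N d] N by (intro tendsto_mult_right_zero) auto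
  ultimately show "(\<lambda>n. fluctuation (\<lambda>y. c * F y) n (N n) / real n) \<longlonglongrightarrow> 0"
    by simp
qed

lemma fluctuation_triangle:
  assumes F: "\<And>i. i \<in> {1..m} \<Longrightarrow> integrable M (\<lambda>\<omega>. F (window n i \<omega>))"
    and G: "\<And>i. i \<in> {1..m} \<Longrightarrow> integrable M (\<lambda>\<omega>. G (window n i \<omega>))"
  shows "fluctuation (\<lambda>y. F y + G y) n m \<le> fluctuation F n m + fluctuation G n m"
proof -
  let ?D = "\<lambda>F \<omega>. \<Sum>i = 1..m. F (window n i \<omega>) - expectation (\<lambda>\<eta>. F (window n i \<eta>))"
  have int: "integrable M (?D F)" "integrable M (?D G)"
    using F G by (auto intro!: Bochner_Integration.integrable_sum Bochner_Integration.integrable_diff)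
  have eq: "?D (\<lambda>y. F y + G y) \<omega> = ?D F \<omega> + ?D G \<omega>" for \<omega>
    unfolding sum.distrib[symmetric] using F G by (intro sum.cong) auto
  have "fluctuation (\<lambda>y. F y + G y) n m = expectation (\<lambda>\<omega>. \<bar>?D F \<omega> + ?D G \<omega>\<bar>)"
    unfolding fluctuation_def eq ..
  also have "\<dots> \<le> expectation (\<lambda>\<omega>. \<bar>?D F \<omega>\<bar> + \<bar>?D G \<omega>\<bar>)"
    using int by (intro integral_mono abs_triangle_ineq integrable_abs
        Bochner_Integration.integrable_add)
  also have "\<dots> = fluctuation F n m + fluctuation G n m"
    unfolding fluctuation_def using int by (intro Bochner_Integration.integral_add integrable_abs)
  finally show ?thesis .
qed

lemma weak_law_add:
  assumes F: "weak_law F" and G: "weak_law G"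
  shows "weak_law (\<lambda>y. F y + G y)"
  unfolding weak_law_def
proof (intro conjI allI impI)
  fix n i :: nat assume "1 \<le> n" "1 \<le> i"
  then show "integrable M (\<lambda>\<omega>. F (window n i \<omega>) + G (window n i \<omega>))"
    using weak_law_integrable[OF F] weak_law_integrable[OF G] by simp
next
  fix N :: "nat \<Rightarrow> nat" and d :: nat assume N: "\<forall>n. N n \<le> d * n"
  have lim: "(\<lambda>n. fluctuation F n (N n) / real n + fluctuation G n (N n) / real n) \<longlonglongrightarrow> 0"
    using weak_law_fluctuation[OF F, of N d] weak_law_fluctuation[OF G, of N d] N
    by (intro tendsto_add_zero) auto
  have "fluctuation (\<lambda>y. F y + G y) n (N n) / real n
      \<le> fluctuation F n (N n) / real n + fluctuation G n (N n) / real n" if "n \<ge> 1" for n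
    unfolding add_divide_distrib[symmetric] using that
    by (intro divide_right_mono fluctuation_triangle weak_law_integrable[OF F] weak_law_integrable[OF G]) auto
  then show "(\<lambda>n. fluctuation (\<lambda>y. F y + G y) n (N n) / real n) \<longlonglongrightarrow> 0"
    by (intro tendsto_sandwich[OF _ eventually_sequentiallyI[of 1] tendsto_const lim])
       (auto simp: fluctuation_nonneg)
qed

lemma weak_law_cos_span: "cos_span k F \<Longrightarrow> weak_law F"
  by (induction rule: cos_span.induct) (intro weak_law_cos_wave weak_law_add weak_law_scale; assumption?)+

lemma fluctuation_le_sum_abs:
  assumes int: "\<And>i. i \<in> {1..m} \<Longrightarrow> integrable M (\<lambda>\<omega>. F (window n i \<omega>))"
    and bound: "\<And>i. i \<in> {1..m} \<Longrightarrow> expectation (\<lambda>\<omega>. \<bar>F (window n i \<omega>)\<bar>) \<le> e"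
  shows "fluctuation F n m \<le> 2 * e * real m"
proof -
  let ?D = "\<lambda>i \<omega>. F (window n i \<omega>) - expectation (\<lambda>\<eta>. F (window n i \<eta>))"
  have D: "integrable M (?D i)" if "i \<in> {1..m}" for i
    using int[OF that] by simp
  have "expectation (\<lambda>\<omega>. \<bar>?D i \<omega>\<bar>) \<le> 2 * e" if i: "i \<in> {1..m}" for i
  proof -
    have "expectation (\<lambda>\<omega>. \<bar>?D i \<omega>\<bar>)
        \<le> expectation (\<lambda>\<omega>. \<bar>F (window n i \<omega>)\<bar> + \<bar>expectation (\<lambda>\<eta>. F (window n i \<eta>))\<bar>)"
      using int[OF i] by (intro integral_mono abs_triangle_ineq4) auto
    also have "\<dots> = expectation (\<lambda>\<omega>. \<bar>F (window n i \<omega>)\<bar>) + \<bar>expectation (\<lambda>\<eta>. F (window n i \<eta>))\<bar>"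
      using int[OF i] by (simp add: prob_space)
    also have "\<bar>expectation (\<lambda>\<eta>. F (window n i \<eta>))\<bar> \<le> expectation (\<lambda>\<omega>. \<bar>F (window n i \<omega>)\<bar>)"
      by (rule integral_abs_bound)
    finally show ?thesis
      using bound[OF i] by linarith
  qed
  then have "(\<Sum>i = 1..m. expectation (\<lambda>\<omega>. \<bar>?D i \<omega>\<bar>)) \<le> (\<Sum>i = 1..m. 2 * e)"
    by (rule sum_mono)
  moreover have "fluctuation F n m \<le> expectation (\<lambda>\<omega>. \<Sum>i = 1..m. \<bar>?D i \<omega>\<bar>)"
    unfolding fluctuation_def using D
    by (intro integral_mono sum_abs integrable_abs Bochner_Integration.integrable_sum)
  moreover have "expectation (\<lambda>\<omega>. \<Sum>i = 1..m. \<bar>?D i \<omega>\<bar>) = (\<Sum>i = 1..m. expectation (\<lambda>\<omega>. \<bar>?D i \<omega>\<bar>))"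
    using D by (intro Bochner_Integration.integral_sum integrable_abs)
  ultimately show ?thesis by (simp add: mult.commute)
qed

text \<open>
  The approximation has to be good uniformly in \<open>n\<close> and \<open>i\<close>. Its total contribution is then at most
  \<open>2 * e\<close> per summand, and there are at most \<open>d * n\<close> summands.
\<close>

lemma weak_law_approximation:
  assumes int: "\<And>n i. n \<ge> 1 \<Longrightarrow> i \<ge> 1 \<Longrightarrow> integrable M (\<lambda>\<omega>. F (window n i \<omega>))"
    and approx: "\<And>e. e > 0 \<Longrightarrow> \<exists>H. weak_law H \<and>
      (\<forall>n\<ge>1. \<forall>i\<ge>1. expectation (\<lambda>\<omega>. \<bar>F (window n i \<omega>) - H (window n i \<omega>)\<bar>) \<le> e)"
  shows "weak_law F"
  unfolding weak_law_def
proof (intro conjI allI impI int)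
  fix N :: "nat \<Rightarrow> nat" and d :: nat assume N: "\<forall>n. N n \<le> d * n"
  show "(\<lambda>n. fluctuation F n (N n) / real n) \<longlonglongrightarrow> 0"
  proof (rule LIMSEQ_I)
    fix \<epsilon> :: real assume \<epsilon>: "0 < \<epsilon>"
    \<comment> \<open>At \<open>2 * e\<close> per summand, the \<open>d * n\<close> summands contribute at most \<open>\<epsilon> / 2\<close> after division by \<open>n\<close>.\<close>
    define e where "e = \<epsilon> / (4 * (real d + 1))"
    have e: "0 < e" using \<epsilon> by (simp add: e_def)
    have de: "2 * e * real d \<le> \<epsilon> / 2"
      using \<epsilon> by (simp add: e_def field_simps)
    obtain H where H: "weak_law H"
      and FH: "\<And>n i. n \<ge> 1 \<Longrightarrow> i \<ge> 1 \<Longrightarrow> expectation (\<lambda>\<omega>. \<bar>F (window n i \<omega>) - H (window n i \<omega>)\<bar>) \<le> e"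
      using approx[OF e] by blast
    obtain n0 where n0: "\<And>n. n \<ge> n0 \<Longrightarrow> norm (fluctuation H n (N n) / real n - 0) < \<epsilon> / 2"
      using LIMSEQ_D[OF weak_law_fluctuation[OF H, of N d], of "\<epsilon> / 2"] N \<epsilon> by auto
    show "\<exists>n0. \<forall>n\<ge>n0. norm (fluctuation F n (N n) / real n - 0) < \<epsilon>"
    proof (intro exI[of _ "max n0 1"] allI impI)
      fix n assume n: "max n0 1 \<le> n"
      let ?R = "\<lambda>y. F y - H y"
      have R: "integrable M (\<lambda>\<omega>. ?R (window n i \<omega>))" if "i \<in> {1..N n}" for i
        using int[of n i] weak_law_integrable[OF H, of n i] that n by simp
      have "fluctuation (\<lambda>y. H y + ?R y) n (N n) \<le> fluctuation H n (N n) + fluctuation ?R n (N n)"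
        using R n by (intro fluctuation_triangle weak_law_integrable[OF H]) auto
      also have "fluctuation ?R n (N n) \<le> 2 * e * real (N n)"
        using n by (intro fluctuation_le_sum_abs R FH) auto
      also have "\<dots> \<le> 2 * e * (real d * real n)"
        using N[rule_format, of n] e by (intro mult_left_mono) (auto simp flip: of_nat_mult)
      finally have "fluctuation F n (N n) \<le> fluctuation H n (N n) + 2 * e * (real d * real n)"
        by simp
      then have "fluctuation F n (N n) / real n \<le> (fluctuation H n (N n) + 2 * e * (real d * real n)) / real n"
        by (rule divide_right_mono) simp
      also have "\<dots> = fluctuation H n (N n) / real n + 2 * e * real d"
        using n by (simp add: add_divide_distrib)
      also have "\<dots> < \<epsilon>"
        using n0[of n] n de unfolding real_norm_def by linarith
      finally show "norm (fluctuation F n (N n) / real n - 0) < \<epsilon>"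
        by (simp add: fluctuation_nonneg)
    qed
  qed
qed

end

section \<open>The weak law for products of powers\<close>

context prob_space
begin

text \<open>
  The right-hand side depends only on \<open>q\<close> and \<open>m\<close>. It is the constant that makes all later estimates
  uniform over the array.
\<close>

lemma std_normal_envelope_moment:
  assumes "distributed M lborel Z std_normal_density"
  shows "integrable M (\<lambda>\<omega>. (2 * power_envelope q (Z \<omega>)) ^ m)"
    and "expectation (\<lambda>\<omega>. (2 * power_envelope q (Z \<omega>)) ^ m) =
      (\<integral>x. std_normal_density x * (2 * power_envelope q x) ^ m \<partial>lborel)"
proof -
  have meas: "(\<lambda>x. (2 * power_envelope q x) ^ m) \<in> borel_measurable lborel"
    unfolding power_envelope_def by measurable
  have binom: "(2 * power_envelope q x) ^ m =
      4 ^ m * (\<Sum>i\<le>(q + 1) * m. real ((q + 1) * m choose i) * \<bar>x\<bar> ^ i)" for x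
  proof -
    have "(2 * power_envelope q x) ^ m = 4 ^ m * (\<bar>x\<bar> + 1) ^ ((q + 1) * m)"
      by (simp add: power_envelope_def power_mult_distrib power_mult[symmetric] add.commute
          flip: power_Suc)
    then show ?thesis
      by (simp only: binomial_ring power_one mult_1_right)
  qed
  have "integrable lborel (\<lambda>x. \<Sum>i\<le>(q + 1) * m. 4 ^ m * real ((q + 1) * m choose i) * (std_normal_density x * \<bar>x\<bar> ^ i))"
    by (intro Bochner_Integration.integrable_sum integrable_mult_right integrable_std_normal_moment_abs)
  then have "integrable lborel (\<lambda>x. std_normal_density x * (2 * power_envelope q x) ^ m)"
    unfolding binom by (simp add: sum_distrib_left mult_ac)
  then show "integrable M (\<lambda>\<omega>. (2 * power_envelope q (Z \<omega>)) ^ m)"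
    using distributed_integrable[OF assms meas] by simp
  show "expectation (\<lambda>\<omega>. (2 * power_envelope q (Z \<omega>)) ^ m) =
      (\<integral>x. std_normal_density x * (2 * power_envelope q x) ^ m \<partial>lborel)"
    using distributed_integral[OF assms meas] by simp
qed

end

context gaussian_array
begin

lemma window_envelope:
  assumes "n \<ge> 1" "i \<ge> 1"
  shows "integrable M (\<lambda>\<omega>. \<Sum>j = 1..k. (2 * power_envelope q (window n i \<omega> j)) ^ m)"
    and "expectation (\<lambda>\<omega>. \<Sum>j = 1..k. (2 * power_envelope q (window n i \<omega> j)) ^ m) =
      real k * (\<integral>x. std_normal_density x * (2 * power_envelope q x) ^ m \<partial>lborel)"
proof -
  have D: "distributed M lborel (\<lambda>\<omega>. window n i \<omega> j) std_normal_density" if "j \<in> {1..k}" for j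
    unfolding window_def by (rule std_normal_entry) (use assms that in auto)
  note moment = std_normal_envelope_moment[OF D, of _ q m]
  show "integrable M (\<lambda>\<omega>. \<Sum>j = 1..k. (2 * power_envelope q (window n i \<omega> j)) ^ m)"
    by (intro Bochner_Integration.integrable_sum moment(1))
  have "expectation (\<lambda>\<omega>. \<Sum>j = 1..k. (2 * power_envelope q (window n i \<omega> j)) ^ m) =
      (\<Sum>j = 1..k. expectation (\<lambda>\<omega>. (2 * power_envelope q (window n i \<omega> j)) ^ m))"
    by (intro Bochner_Integration.integral_sum moment(1))
  also have "\<dots> = (\<Sum>j = 1..k. \<integral>x. std_normal_density x * (2 * power_envelope q x) ^ m \<partial>lborel)"
    by (intro sum.cong refl moment(2))
  finally show "expectation (\<lambda>\<omega>. \<Sum>j = 1..k. (2 * power_envelope q (window n i \<omega> j)) ^ m) =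
      real k * (\<integral>x. std_normal_density x * (2 * power_envelope q x) ^ m \<partial>lborel)"
    by simp
qed

text \<open>
  The product is dominated by a sum over the coordinates, so the bound sees only the standard normal
  marginals of the window and not its joint law, which varies with \<open>n\<close>.
\<close>

lemma abs_power_product_moment:
  assumes k: "k \<ge> 1" and p: "\<And>j. j \<in> {1..k} \<Longrightarrow> 0 \<le> p j" "\<And>j. j \<in> {1..k} \<Longrightarrow> p j \<le> real q"
    and n: "n \<ge> 1" and i: "i \<ge> 1"
  shows "integrable M (\<lambda>\<omega>. \<Prod>j = 1..k. abs_power (window n i \<omega> j) (p j))"
    and "expectation (\<lambda>\<omega>. \<Prod>j = 1..k. abs_power (window n i \<omega> j) (p j)) \<le>
      real k * (\<integral>x. std_normal_density x * (2 * power_envelope q x) ^ k \<partial>lborel)"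
proof -
  let ?G = "\<lambda>\<omega>. \<Prod>j = 1..k. abs_power (window n i \<omega> j) (p j)"
  let ?W = "\<lambda>\<omega>. \<Sum>j = 1..k. (2 * power_envelope q (window n i \<omega> j)) ^ k"
  have "?G \<omega> \<le> (\<Prod>j = 1..k. 2 * power_envelope q (window n i \<omega> j))" for \<omega>
  proof (intro prod_mono conjI abs_power_nonneg)
    fix j assume "j \<in> {1..k}"
    then show "abs_power (window n i \<omega> j) (p j) \<le> 2 * power_envelope q (window n i \<omega> j)"
      using abs_power_le_envelope(2)[OF p, of j "window n i \<omega> j"] power_envelope_pos[of q "window n i \<omega> j"]
      by linarith
  qed
  also have "(\<Prod>j = 1..k. 2 * power_envelope q (window n i \<omega> j)) \<le> ?W \<omega>" for \<omega>
    using prod_le_sum_power[of "{1..k}" "\<lambda>j. 2 * power_envelope q (window n i \<omega> j)"] k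
    by (simp add: power_envelope_pos less_imp_le)
  finally have le: "?G \<omega> \<le> ?W \<omega>" for \<omega> .
  have nonneg: "0 \<le> ?G \<omega>" for \<omega>
    by (intro prod_nonneg abs_power_nonneg)
  have meas: "?G \<in> borel_measurable M"
    by (intro borel_measurable_prod measurable_compose[OF measurable_window_coordinate borel_measurable_abs_power] n i) auto
  show int: "integrable M ?G"
  proof (rule Bochner_Integration.integrable_bound[OF window_envelope(1)[OF n i] meas])
    show "AE \<omega> in M. norm (?G \<omega>) \<le> norm (?W \<omega>)"
    proof (rule AE_I2)
      fix \<omega> show "norm (?G \<omega>) \<le> norm (?W \<omega>)"
        using nonneg[of \<omega>] le[of \<omega>] unfolding real_norm_def by linarith
    qed
  qed
  have "expectation ?G \<le> expectation ?W"
    by (intro integral_mono int window_envelope(1)[OF n i] le)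
  then show "expectation ?G \<le> real k * (\<integral>x. std_normal_density x * (2 * power_envelope q x) ^ k \<partial>lborel)"
    unfolding window_envelope(2)[OF n i] .
qed

text \<open>
  Each power is replaced by a polynomial in \<open>cos (\<pi> / L * y\<^sub>j)\<close>. The product of these polynomials lies in the
  span of the cosines, and its distance to the product of the powers is at most \<open>k / L\<close> times a
  variable whose mean \<open>k * c\<close> does not depend on the window.
\<close>

lemma weak_law_abs_power_product:
  assumes k: "k \<ge> 1" and p: "\<And>j. j \<in> {1..k} \<Longrightarrow> 0 \<le> p j"
  shows "weak_law (\<lambda>y. \<Prod>j = 1..k. abs_power (y j) (p j))"
proof -
  obtain q :: nat where q: "\<And>j. j \<in> {1..k} \<Longrightarrow> p j \<le> real q"
    using exponents_bounded[of k p] by blast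
  define c where "c = (\<integral>x. std_normal_density x * (2 * power_envelope q x) ^ k \<partial>lborel)"
  have "0 \<le> c"
    unfolding c_def by (intro Bochner_Integration.integral_nonneg) (simp add: power_envelope_pos less_imp_le)
  show ?thesis
  proof (rule weak_law_approximation)
    fix n i :: nat assume "n \<ge> 1" "i \<ge> 1"
    then show "integrable M (\<lambda>\<omega>. \<Prod>j = 1..k. abs_power (window n i \<omega> j) (p j))"
      by (intro abs_power_product_moment(1)[OF k p q])
  next
    fix e :: real assume e: "e > 0"
    \<comment> \<open>The scale is large enough to make the mean error \<open>k / L * (k * c)\<close> at most \<open>e\<close>.\<close>
    define L where "L = 1 + real k * (real k * c) / e"
    have L: "1 \<le> L"
      using e \<open>0 \<le> c\<close> by (simp add: L_def)
    have "real k * (real k * c) \<le> e * L"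
      using e by (simp add: L_def distrib_left)
    then have L_error: "real k / L * (real k * c) \<le> e"
      using L by (simp add: pos_divide_le_eq)
    have choice: "\<forall>j\<in>{1..k}. \<exists>g. real_polynomial_function g \<and>
        (\<forall>x. \<bar>abs_power x (p j) - g (cos (pi / L * x))\<bar> \<le> power_envelope q x / L)"
      by (intro ballI abs_power_cos_approximation p q L)
    from bchoice[OF choice] obtain g where g_all: "\<forall>j\<in>{1..k}. real_polynomial_function (g j) \<and>
        (\<forall>x. \<bar>abs_power x (p j) - g j (cos (pi / L * x))\<bar> \<le> power_envelope q x / L)"
      ..
    have g: "real_polynomial_function (g j)" if "j \<in> {1..k}" for j
      using g_all that by simp
    have approx: "\<bar>abs_power x (p j) - g j (cos (pi / L * x))\<bar> \<le> power_envelope q x / L"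
      if "j \<in> {1..k}" for j x
      using g_all that by simp
    define H where "H y = (\<Prod>j = 1..k. g j (cos (pi / L * y j)))" for y :: "nat \<Rightarrow> real"
    have "cos_span k H"
      unfolding H_def
    proof (rule cos_span_prod)
      fix j assume j: "j \<in> {1..k}"
      from cos_span_polynomial[OF g[OF j] cos_span_coordinate[OF j]]
      show "cos_span k (\<lambda>y. g j (cos (pi / L * y j)))" .
    qed
    then have H: "weak_law H"
      by (rule weak_law_cos_span)
    have "expectation (\<lambda>\<omega>. \<bar>(\<Prod>j = 1..k. abs_power (window n i \<omega> j) (p j)) - H (window n i \<omega>)\<bar>) \<le> e"
      if n: "n \<ge> 1" and i: "i \<ge> 1" for n i
    proof -
      have near: "\<bar>(\<Prod>j = 1..k. abs_power (y j) (p j)) - H y\<bar>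
          \<le> real k / L * (\<Sum>j = 1..k. (2 * power_envelope q (y j)) ^ k)" for y
      proof -
        have "\<bar>(\<Prod>j = 1..k. abs_power (y j) (p j)) - H y\<bar>
            \<le> real (card {1..k}) / L * (\<Sum>j = 1..k. (2 * power_envelope q (y j)) ^ card {1..k})"
          unfolding H_def
        proof (rule prod_diff_le_envelope)
          fix j assume j: "j \<in> {1..k}"
          show "\<bar>abs_power (y j) (p j)\<bar> \<le> power_envelope q (y j)"
            using abs_power_le_envelope(2)[OF p[OF j] q[OF j]] by (simp add: abs_power_nonneg)
          show "\<bar>abs_power (y j) (p j) - g j (cos (pi / L * y j))\<bar> \<le> power_envelope q (y j) / L"
            by (rule approx[OF j])
        qed (use k L in \<open>auto simp: power_envelope_pos\<close>)
        then show ?thesis by simp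
      qed
      have "expectation (\<lambda>\<omega>. \<bar>(\<Prod>j = 1..k. abs_power (window n i \<omega> j) (p j)) - H (window n i \<omega>)\<bar>)
          \<le> expectation (\<lambda>\<omega>. real k / L * (\<Sum>j = 1..k. (2 * power_envelope q (window n i \<omega> j)) ^ k))"
      proof (rule integral_mono)
        show "integrable M (\<lambda>\<omega>. \<bar>(\<Prod>j = 1..k. abs_power (window n i \<omega> j) (p j)) - H (window n i \<omega>)\<bar>)"
          by (rule integrable_abs, rule Bochner_Integration.integrable_diff,
              rule abs_power_product_moment(1)[OF k p q n i], assumption, assumption,
              rule weak_law_integrable[OF H n i])
        show "integrable M (\<lambda>\<omega>. real k / L * (\<Sum>j = 1..k. (2 * power_envelope q (window n i \<omega> j)) ^ k))"
          by (rule integrable_mult_right, rule window_envelope(1)[OF n i])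
      qed (rule near)
      also have "\<dots> = real k / L * (real k * c)"
        unfolding integral_mult_right_zero window_envelope(2)[OF n i] c_def ..
      also have "\<dots> \<le> e"
        by (rule L_error)
      finally show ?thesis .
    qed
    with H show "\<exists>H. weak_law H \<and> (\<forall>n\<ge>1. \<forall>i\<ge>1. expectation (\<lambda>\<omega>.
        \<bar>(\<Prod>j = 1..k. abs_power (window n i \<omega> j) (p j)) - H (window n i \<omega>)\<bar>) \<le> e)"
      by blast
  qed
qed

end

section \<open>From convergence at fixed times to uniform convergence\<close>

context prob_space
begin

text \<open>
  If \<open>V\<close> is close to \<open>\<rho> t\<close> at two neighbouring grid points, then by monotonicity it is close in between,
  with an additional error of at most \<open>C\<close> times the mesh. For the measurability of the supremum, note that \<open>V\<close> takes the
  single value \<open>v n m\<close> while \<open>[nt] = m\<close>, so the event that the supremum exceeds a level is a countable union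
  of events that some \<open>v n m\<close> lies in an open set.
\<close>

lemma ucp_tendsto_step_process:
  fixes v :: "nat \<Rightarrow> nat \<Rightarrow> 'a \<Rightarrow> real" and \<rho> :: "nat \<Rightarrow> real"
  defines "V \<equiv> \<lambda>n t. v n (nat \<lfloor>real n * t\<rfloor>)"
  assumes meas: "\<And>n m. n \<ge> 1 \<Longrightarrow> v n m \<in> borel_measurable M"
    and mono: "\<And>n m m' \<omega>. m \<le> m' \<Longrightarrow> v n m \<omega> \<le> v n m' \<omega>"
    and rho: "\<And>n. n \<ge> 1 \<Longrightarrow> \<rho> n \<in> {0..C}"
    and pointwise: "\<And>t e. t \<ge> 0 \<Longrightarrow> e > 0 \<Longrightarrow>
      (\<lambda>n. prob {\<omega>\<in>space M. \<bar>V n t \<omega> - \<rho> n * t\<bar> > e}) \<longlonglongrightarrow> 0"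
  shows "ucp_tendsto M (\<lambda>n t \<omega>. V n t \<omega> - \<rho> n * t) (\<lambda>t \<omega>. 0)"
  unfolding ucp_tendsto_def
proof (intro allI impI conjI)
  fix T :: real and n :: nat assume "0 < T" "1 \<le> n"
  show "(\<lambda>\<omega>. SUP t\<in>{0..T}. ennreal \<bar>V n t \<omega> - \<rho> n * t - 0\<bar>) \<in> borel_measurable M"
  proof (rule borel_measurableI_greater)
    fix y :: ennreal
    define U where "U m = (\<Union>t\<in>{t\<in>{0..T}. nat \<lfloor>real n * t\<rfloor> = m}. {x::real. y < ennreal \<bar>x - \<rho> n * t\<bar>})" for m
    have "open (U m)" for m
      unfolding U_def by (intro open_UN ballI open_Collect_less continuous_on_ennreal continuous_intros)
    then have [measurable]: "U m \<in> sets borel" for m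
      by (rule borel_open)
    have [measurable]: "v n m \<in> borel_measurable M" for m
      using meas \<open>1 \<le> n\<close> by blast
    have "{\<omega> \<in> space M. y < (SUP t\<in>{0..T}. ennreal \<bar>V n t \<omega> - \<rho> n * t - 0\<bar>)} =
        (\<Union>m. {\<omega> \<in> space M. v n m \<omega> \<in> U m})"
      by (auto simp: less_SUP_iff U_def V_def)
    also have "\<dots> \<in> sets M"
      by measurable
    finally show "{\<omega> \<in> space M. y < (SUP t\<in>{0..T}. ennreal \<bar>V n t \<omega> - \<rho> n * t - 0\<bar>)} \<in> sets M" .
  qed
next
  fix T \<epsilon> :: real assume T: "0 < T" and \<epsilon>: "0 < \<epsilon>"
  \<comment> \<open>The number of grid cells is chosen so that the slope contributes at most half of the tolerance per cell.\<close>
  define K where "K = nat \<lceil>2 * C * T / \<epsilon>\<rceil> + 1"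
  define \<delta> where "\<delta> = T / real K"
  have \<delta>: "0 < \<delta>"
    using T by (simp add: \<delta>_def K_def)
  have "2 * C * T / \<epsilon> \<le> real K"
    unfolding K_def by linarith
  then have C\<delta>: "C * \<delta> \<le> \<epsilon> / 2"
    using \<epsilon> by (simp add: \<delta>_def K_def field_simps)
  define E where "E n j = {\<omega>\<in>space M. \<bar>V n (real j * \<delta>) \<omega> - \<rho> n * (real j * \<delta>)\<bar> > \<epsilon> / 2}" for n j
  have E_sets: "E n j \<in> sets M" if "n \<ge> 1" for n j
  proof -
    have [measurable]: "V n (real j * \<delta>) \<in> borel_measurable M"
      using meas that by (simp add: V_def)
    show ?thesis unfolding E_def by measurable
  qed
  \<comment> \<open>The grid reaches one point beyond the interval, since the right neighbour of its end is needed.\<close>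
  have sub: "{\<omega>\<in>space M. (SUP t\<in>{0..T}. ennreal \<bar>V n t \<omega> - \<rho> n * t - 0\<bar>) > ennreal \<epsilon>} \<subseteq> (\<Union>j\<in>{..K + 1}. E n j)"
    if n: "n \<ge> 1" for n
  proof
    fix \<omega> assume "\<omega> \<in> {\<omega>\<in>space M. (SUP t\<in>{0..T}. ennreal \<bar>V n t \<omega> - \<rho> n * t - 0\<bar>) > ennreal \<epsilon>}"
    then obtain t where \<omega>: "\<omega> \<in> space M" and t: "0 \<le> t" "t \<le> T" and big: "\<epsilon> < \<bar>V n t \<omega> - \<rho> n * t\<bar>"
      using \<epsilon> by (auto simp: less_SUP_iff ennreal_less_iff)
    define j where "j = nat \<lfloor>t / \<delta>\<rfloor>"
    have "real j \<le> t / \<delta>" "t / \<delta> < real j + 1"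
      using t \<delta> by (auto simp: j_def of_nat_nat floor_less_iff)
    then have grid: "real j * \<delta> \<le> t" "t \<le> real (j + 1) * \<delta>"
      using \<delta> by (simp_all add: field_simps)
    have "t / \<delta> \<le> real K"
      using t T mult_right_mono[of "t / T" 1 "real K"] by (simp add: \<delta>_def)
    with \<open>real j \<le> t / \<delta>\<close> have "j \<le> K" by linarith
    have "\<omega> \<in> E n j \<or> \<omega> \<in> E n (j + 1)"
    proof (rule ccontr)
      assume "\<not> (\<omega> \<in> E n j \<or> \<omega> \<in> E n (j + 1))"
      then have ends: "\<bar>V n (real j * \<delta>) \<omega> - \<rho> n * (real j * \<delta>)\<bar> \<le> \<epsilon> / 2"
        "\<bar>V n (real (j + 1) * \<delta>) \<omega> - \<rho> n * (real (j + 1) * \<delta>)\<bar> \<le> \<epsilon> / 2"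
        using \<omega> by (auto simp: E_def not_less)
      have V: "V n (real j * \<delta>) \<omega> \<le> V n t \<omega>" "V n t \<omega> \<le> V n (real (j + 1) * \<delta>) \<omega>"
        unfolding V_def using grid by (intro mono nat_mono floor_mono mult_left_mono; simp)+
      have "\<rho> n * \<delta> \<le> C * \<delta>"
        using rho[OF n] \<delta> by (intro mult_right_mono) auto
      with C\<delta> have step: "\<rho> n * (real (j + 1) * \<delta>) - \<rho> n * (real j * \<delta>) \<le> \<epsilon> / 2"
        by (simp add: algebra_simps)
      have "\<rho> n * (real j * \<delta>) \<le> \<rho> n * t" "\<rho> n * t \<le> \<rho> n * (real (j + 1) * \<delta>)"
        using rho[OF n] grid by (auto intro!: mult_left_mono)
      with ends V step big show False by linarith
    qed
    with \<open>j \<le> K\<close> show "\<omega> \<in> (\<Union>j\<in>{..K + 1}. E n j)" by auto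
  qed
  have bound: "prob {\<omega>\<in>space M. (SUP t\<in>{0..T}. ennreal \<bar>V n t \<omega> - \<rho> n * t - 0\<bar>) > ennreal \<epsilon>} \<le> (\<Sum>j\<le>K + 1. prob (E n j))"
    if "n \<ge> 1" for n
  proof -
    have "prob {\<omega>\<in>space M. (SUP t\<in>{0..T}. ennreal \<bar>V n t \<omega> - \<rho> n * t - 0\<bar>) > ennreal \<epsilon>} \<le> prob (\<Union>j\<in>{..K + 1}. E n j)"
      using E_sets that by (intro finite_measure_mono sub) auto
    also have "\<dots> \<le> (\<Sum>j\<le>K + 1. prob (E n j))"
      using E_sets that by (intro finite_measure_subadditive_finite) auto
    finally show ?thesis .
  qed
  have "(\<lambda>n. \<Sum>j\<le>K + 1. prob (E n j)) \<longlonglongrightarrow> (\<Sum>j\<le>K + 1. 0)"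
    unfolding E_def using \<delta> \<epsilon> by (intro tendsto_sum pointwise) auto
  then have lim: "(\<lambda>n. \<Sum>j\<le>K + 1. prob (E n j)) \<longlonglongrightarrow> 0" by simp
  show "(\<lambda>n. prob {\<omega>\<in>space M. (SUP t\<in>{0..T}. ennreal \<bar>V n t \<omega> - \<rho> n * t - 0\<bar>) > ennreal \<epsilon>}) \<longlonglongrightarrow> 0"
  proof (rule tendsto_sandwich[OF _ _ tendsto_const lim])
    show "\<forall>\<^sub>F n in sequentially. prob {\<omega>\<in>space M. (SUP t\<in>{0..T}. ennreal \<bar>V n t \<omega> - \<rho> n * t - 0\<bar>) > ennreal \<epsilon>} \<le> (\<Sum>j\<le>K + 1. prob (E n j))"
      by (rule eventually_sequentiallyI[of 1], rule bound)
  qed simp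
qed

lemma prob_abs_gt_tendsto_0:
  fixes Y :: "nat \<Rightarrow> 'a \<Rightarrow> real"
  assumes int: "\<And>n. n \<ge> 1 \<Longrightarrow> integrable M (Y n)"
    and lim: "(\<lambda>n. expectation (\<lambda>\<omega>. \<bar>Y n \<omega>\<bar>)) \<longlonglongrightarrow> 0" and e: "0 < e"
  shows "(\<lambda>n. prob {\<omega>\<in>space M. \<bar>Y n \<omega>\<bar> > e}) \<longlonglongrightarrow> 0"
proof (rule tendsto_sandwich[OF _ _ tendsto_const])
  show "(\<lambda>n. expectation (\<lambda>\<omega>. \<bar>Y n \<omega>\<bar>) / e) \<longlonglongrightarrow> 0"
    using tendsto_divide[OF lim tendsto_const[of e]] e by simp
  show "\<forall>\<^sub>F n in sequentially. prob {\<omega>\<in>space M. \<bar>Y n \<omega>\<bar> > e} \<le> expectation (\<lambda>\<omega>. \<bar>Y n \<omega>\<bar>) / e"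
  proof (rule eventually_sequentiallyI[of 1])
    fix n :: nat assume n: "1 \<le> n"
    have [measurable]: "Y n \<in> borel_measurable M"
      using int[OF n] by simp
    have "prob {\<omega>\<in>space M. \<bar>Y n \<omega>\<bar> > e} \<le> prob {\<omega>\<in>space M. \<bar>Y n \<omega>\<bar> \<ge> e}"
      by (intro finite_measure_mono) auto
    also have "\<dots> \<le> expectation (\<lambda>\<omega>. \<bar>Y n \<omega>\<bar>) / e"
      using int[OF n] e by (intro integral_Markov_inequality_measure[where A = "{}"]) auto
    finally show "prob {\<omega>\<in>space M. \<bar>Y n \<omega>\<bar> > e} \<le> expectation (\<lambda>\<omega>. \<bar>Y n \<omega>\<bar>) / e" .
  qed
qed simp

end

section \<open>Multipower variation\<close>

text \<open>
  Stationarity enters in two ways: it makes the covariances depend on the lag alone, and it gives all windows of a row the same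
  mean \<open>\<rho>\<^sup>(\<^sup>n\<^sup>)\<close>.
\<close>

lemma stationary_expectation:
  fixes \<Phi> :: "(nat \<Rightarrow> real) \<Rightarrow> real"
  assumes "stationary M Y" "finite J" "J \<subseteq> {1..}"
    and meas: "\<And>i. i \<ge> 1 \<Longrightarrow> Y i \<in> borel_measurable M"
    and \<Phi>: "\<Phi> \<in> borel_measurable (PiM J (\<lambda>_. borel))"
  shows "(\<integral>\<omega>. \<Phi> (\<lambda>i\<in>J. Y (i + h) \<omega>) \<partial>M) = (\<integral>\<omega>. \<Phi> (\<lambda>i\<in>J. Y i \<omega>) \<partial>M)"
proof -
  have shift: "(\<lambda>\<omega>. \<lambda>i\<in>J. Y (i + l) \<omega>) \<in> measurable M (PiM J (\<lambda>_. borel))" for l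
    using assms(3) by (intro measurable_restrict meas) auto
  have "(\<integral>\<omega>. \<Phi> (\<lambda>i\<in>J. Y (i + h) \<omega>) \<partial>M) =
      (\<integral>y. \<Phi> y \<partial>distr M (PiM J (\<lambda>_. borel)) (\<lambda>\<omega>. \<lambda>i\<in>J. Y (i + h) \<omega>))"
    by (rule integral_distr[symmetric, OF shift \<Phi>])
  also have "distr M (PiM J (\<lambda>_. borel)) (\<lambda>\<omega>. \<lambda>i\<in>J. Y (i + h) \<omega>) =
      distr M (PiM J (\<lambda>_. borel)) (\<lambda>\<omega>. \<lambda>i\<in>J. Y (i + 0) \<omega>)"
    using assms by (simp add: stationary_def)
  also have "(\<integral>y. \<Phi> y \<partial>distr M (PiM J (\<lambda>_. borel)) (\<lambda>\<omega>. \<lambda>i\<in>J. Y (i + 0) \<omega>)) =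
      (\<integral>\<omega>. \<Phi> (\<lambda>i\<in>J. Y (i + 0) \<omega>) \<partial>M)"
    by (rule integral_distr[OF shift \<Phi>])
  finally show ?thesis
    unfolding add_0_right .
qed

theorem theorem1:
  fixes M :: "'a measure"
    and X :: "nat \<Rightarrow> nat \<Rightarrow> 'a \<Rightarrow> real"
    and k :: nat
    and p :: "nat \<Rightarrow> real"
    and r :: "nat \<Rightarrow> real"
  assumes "prob_space M"
    and gaussian: "\<And>n. n \<ge> 1 \<Longrightarrow> gaussian_process M {1..} (X n)"
    and stationary: "\<And>n. n \<ge> 1 \<Longrightarrow> stationary M (X n)"
    and mean: "\<And>n i. n \<ge> 1 \<Longrightarrow> i \<ge> 1 \<Longrightarrow> (\<integral>\<omega>. X n i \<omega> \<partial>M) = 0"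
    and variance: "\<And>n i. n \<ge> 1 \<Longrightarrow> i \<ge> 1 \<Longrightarrow> prob_space.variance M (X n i) = 1"
    and nondegenerate: "nondegenerate M X"
    and k: "k \<ge> 1"
    and p: "\<And>j. 1 \<le> j \<Longrightarrow> j \<le> k \<Longrightarrow> p j \<ge> 0"
    and r_bound: "\<And>n j. n \<ge> 1 \<Longrightarrow> j \<ge> 1 \<Longrightarrow> (cor M (X n 1) (X n (1 + j)))\<^sup>2 \<le> r j"
    and r_mean: "(\<lambda>n. 1 / real n * (\<Sum>j = 1..n - 1. r j)) \<longlonglongrightarrow> 0"
  shows "ucp_tendsto M
           (\<lambda>n t \<omega>. multipower_variation X k p n t \<omega> - rho M X k p n * t) (\<lambda>t \<omega>. 0)"
proof -
  interpret prob_space M by fact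
  have meas: "X n i \<in> borel_measurable M" if "n \<ge> 1" "i \<ge> 1" for n i
    using gaussian_process_linear_combination[OF gaussian[OF that(1)], of "{i}" "\<lambda>x. x" "\<lambda>_. 1"] that
    by (simp add: gaussian_rv_def)
  have second_moment: "expectation (\<lambda>\<omega>. (X n i \<omega>)\<^sup>2) = 1" if "n \<ge> 1" "i \<ge> 1" for n i
    using variance[OF that] mean[OF that] by simp
  have decay: "(expectation (\<lambda>\<omega>. X n a \<omega> * X n b \<omega>))\<^sup>2 \<le> r (b - a)"
    if n: "n \<ge> 1" and ab: "1 \<le> a" "a < b" for n a b
  proof -
    have "expectation (\<lambda>\<omega>. X n a \<omega> * X n b \<omega>) = expectation (\<lambda>\<omega>. X n 1 \<omega> * X n (1 + (b - a)) \<omega>)"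
    proof -
      let ?J = "{1, 1 + (b - a)}"
      have product: "(\<lambda>y. y 1 * y (1 + (b - a))) \<in> borel_measurable (PiM ?J (\<lambda>_. borel :: real measure))"
        by (intro borel_measurable_times measurable_component_singleton) auto
      have "expectation (\<lambda>\<omega>. (\<lambda>i\<in>?J. X n (i + (a - 1)) \<omega>) 1 * (\<lambda>i\<in>?J. X n (i + (a - 1)) \<omega>) (1 + (b - a))) =
          expectation (\<lambda>\<omega>. (\<lambda>i\<in>?J. X n i \<omega>) 1 * (\<lambda>i\<in>?J. X n i \<omega>) (1 + (b - a)))"
        by (rule stationary_expectation[OF stationary[OF n] _ _ meas[OF n] product]) auto
      moreover have "1 + (a - 1) = a" "1 + (b - a) + (a - 1) = b"
        using ab by auto
      ultimately show ?thesis by (simp only: restrict_apply insert_iff simp_thms if_True)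
    qed
    also have "\<dots> = cor M (X n 1) (X n (1 + (b - a)))"
      using mean[OF n] second_moment[OF n] by (simp add: cor_def cov_def power2_eq_square)
    finally show ?thesis
      using r_bound[OF n, of "b - a"] ab by simp
  qed
  interpret gaussian_array M X r
    by unfold_locales (use gaussian mean second_moment decay r_mean in auto)

  define G where "G y = (\<Prod>j = 1..k. abs_power (y j) (p j))" for y :: "nat \<Rightarrow> real"
  define v where "v n m \<omega> = 1 / real n * (\<Sum>i = 1..m + 1 - k. G (window n i \<omega>))" for n m \<omega>
  have G_nonneg: "0 \<le> G y" for y
    unfolding G_def by (intro prod_nonneg abs_power_nonneg)
  have p': "0 \<le> p j" if "j \<in> {1..k}" for j
    using p that by simp
  have law: "weak_law G"
    unfolding G_def by (rule weak_law_abs_power_product[OF k p'])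
  have multipower: "multipower_variation X k p n t \<omega> = v n (nat \<lfloor>real n * t\<rfloor>) \<omega>" for n t \<omega>
    by (simp add: multipower_variation_def v_def G_def window_def)
  have rho: "expectation (\<lambda>\<omega>. G (window n i \<omega>)) = rho M X k p n" if n: "n \<ge> 1" and i: "i \<ge> 1" for n i
  proof -
    have "G \<in> borel_measurable (PiM {1..k} (\<lambda>_. borel))"
      unfolding G_def by measurable
    moreover have "G (window n i \<omega>) = G (\<lambda>j\<in>{1..k}. X n (j + (i - 1)) \<omega>)" for \<omega>
      using i by (auto simp: G_def window_def add.commute intro!: prod.cong)
    moreover have "(\<Prod>j = 1..k. abs_power (X n j \<omega>) (p j)) = G (\<lambda>j\<in>{1..k}. X n j \<omega>)" for \<omega>
      by (auto simp: G_def intro!: prod.cong)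
    ultimately show ?thesis
      using stationary_expectation[OF stationary[OF n], of "{1..k}" G "i - 1"] meas[OF n]
      by (simp add: rho_def)
  qed
  obtain C where C: "\<And>n. n \<ge> 1 \<Longrightarrow> rho M X k p n \<in> {0..C}"
  proof -
    obtain q :: nat where q: "\<And>j. j \<in> {1..k} \<Longrightarrow> p j \<le> real q"
      using exponents_bounded[of k p] by blast
    show thesis
    proof (rule that)
      fix n :: nat assume n: "n \<ge> 1"
      have "0 \<le> rho M X k p n"
        unfolding rho[OF n order_refl, symmetric] by (simp add: G_nonneg)
      moreover have "rho M X k p n \<le> real k * (\<integral>x. std_normal_density x * (2 * power_envelope q x) ^ k \<partial>lborel)"
        unfolding rho[OF n order_refl, symmetric] G_def
        by (rule abs_power_product_moment(2)[OF k p' q n order_refl])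
      ultimately show "rho M X k p n \<in> {0..real k * (\<integral>x. std_normal_density x * (2 * power_envelope q x) ^ k \<partial>lborel)}"
        by simp
    qed
  qed
  have int: "integrable M (\<lambda>\<omega>. G (window n i \<omega>))" if "n \<ge> 1" "i \<ge> 1" for n i
    using weak_law_integrable[OF law that] .
  have v_int: "integrable M (v n m)" if "n \<ge> 1" for n m
    unfolding v_def using int[OF that] by (intro integrable_mult_right Bochner_Integration.integrable_sum) auto
  have pointwise: "(\<lambda>n. expectation (\<lambda>\<omega>. \<bar>v n (nat \<lfloor>real n * t\<rfloor>) \<omega> - rho M X k p n * t\<bar>)) \<longlonglongrightarrow> 0"
    if t: "0 \<le> t" for t
  proof -
    \<comment> \<open>The number of windows differs from \<open>n t\<close> by at most \<open>k\<close>, which is negligible after division by \<open>n\<close>.\<close>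
    define N where "N n = nat \<lfloor>real n * t\<rfloor> + 1 - k" for n
    have N_le: "real (N n) \<le> real n * t" and N_ge: "real n * t - real (N n) \<le> real k" for n
    proof -
      define m where "m = nat \<lfloor>real n * t\<rfloor>"
      have "0 \<le> real n * t" using t by simp
      then have "real m \<le> real n * t" "real n * t < real m + 1"
        unfolding m_def by linarith+
      moreover have "N n = m + 1 - k"
        by (simp add: N_def m_def)
      ultimately show "real (N n) \<le> real n * t" "real n * t - real (N n) \<le> real k"
        using k \<open>0 \<le> real n * t\<close> by (cases "k \<le> m + 1"; simp add: of_nat_diff)+
    qed
    have N_lin: "N n \<le> nat \<lceil>t\<rceil> * n" for n
    proof -
      have "real (N n) \<le> real n * t" by (rule N_le)
      also have "\<dots> \<le> real n * real (nat \<lceil>t\<rceil>)"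
        by (intro mult_left_mono) linarith+
      finally show ?thesis
        by (simp add: mult.commute flip: of_nat_mult)
    qed
    have bound: "expectation (\<lambda>\<omega>. \<bar>v n (nat \<lfloor>real n * t\<rfloor>) \<omega> - rho M X k p n * t\<bar>)
        \<le> fluctuation G n (N n) / real n + C * real k / real n" if n: "n \<ge> 1" for n
    proof -
      let ?D = "\<lambda>\<omega>. \<Sum>i = 1..N n. G (window n i \<omega>) - expectation (\<lambda>\<eta>. G (window n i \<eta>))"
      have D_int: "integrable M ?D"
        using int[OF n] by (auto intro!: Bochner_Integration.integrable_sum Bochner_Integration.integrable_diff)
      have "?D \<omega> = (\<Sum>i = 1..N n. G (window n i \<omega>)) - real (N n) * rho M X k p n" for \<omega>
        using rho[OF n] by (simp add: sum_subtractf)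
      moreover have "v n (nat \<lfloor>real n * t\<rfloor>) \<omega> = (\<Sum>i = 1..N n. G (window n i \<omega>)) / real n" for \<omega>
        by (simp add: v_def N_def)
      ultimately have v_eq: "v n (nat \<lfloor>real n * t\<rfloor>) \<omega> - rho M X k p n * t =
          ?D \<omega> / real n - rho M X k p n * (real n * t - real (N n)) / real n" for \<omega>
        using n by (simp add: field_simps)
      have "rho M X k p n * (real n * t - real (N n)) \<le> C * real k"
        using C[OF n] N_le[of n] N_ge[of n] by (intro mult_mono) auto
      then have "\<bar>v n (nat \<lfloor>real n * t\<rfloor>) \<omega> - rho M X k p n * t\<bar> \<le> \<bar>?D \<omega>\<bar> / real n + C * real k / real n" for \<omega>
      proof -
        have "\<bar>v n (nat \<lfloor>real n * t\<rfloor>) \<omega> - rho M X k p n * t\<bar>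
            \<le> \<bar>?D \<omega> / real n\<bar> + \<bar>rho M X k p n * (real n * t - real (N n)) / real n\<bar>"
          unfolding v_eq by (rule abs_triangle_ineq4)
        also have "\<bar>?D \<omega> / real n\<bar> = \<bar>?D \<omega>\<bar> / real n" by simp
        also have "\<bar>rho M X k p n * (real n * t - real (N n)) / real n\<bar> =
            rho M X k p n * (real n * t - real (N n)) / real n"
          using C[OF n] N_le[of n] by simp
        also have "\<dots> \<le> C * real k / real n"
          by (intro divide_right_mono) (fact, simp)
        finally show ?thesis by simp
      qed
      then have "expectation (\<lambda>\<omega>. \<bar>v n (nat \<lfloor>real n * t\<rfloor>) \<omega> - rho M X k p n * t\<bar>)
          \<le> expectation (\<lambda>\<omega>. \<bar>?D \<omega>\<bar> / real n + C * real k / real n)"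
        using v_int[OF n] D_int
        by (intro integral_mono) (auto intro!: integrable_abs Bochner_Integration.integrable_add Bochner_Integration.integrable_diff)
      also have "\<dots> = fluctuation G n (N n) / real n + C * real k / real n"
        unfolding fluctuation_def using integrable_abs[OF D_int] by (simp add: prob_space)
      finally show ?thesis .
    qed
    have "(\<lambda>n. fluctuation G n (N n) / real n + C * real k * (1 / real n)) \<longlonglongrightarrow> 0 + C * real k * 0"
      by (intro tendsto_intros weak_law_fluctuation[OF law N_lin] lim_1_over_n)
    then have lim: "(\<lambda>n. fluctuation G n (N n) / real n + C * real k / real n) \<longlonglongrightarrow> 0" by simp
    show ?thesis
    proof (rule tendsto_sandwich[OF _ _ tendsto_const lim])
      show "\<forall>\<^sub>F n in sequentially. expectation (\<lambda>\<omega>. \<bar>v n (nat \<lfloor>real n * t\<rfloor>) \<omega> - rho M X k p n * t\<bar>)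
          \<le> fluctuation G n (N n) / real n + C * real k / real n"
        by (rule eventually_sequentiallyI[of 1], rule bound)
    qed simp
  qed
  show ?thesis
    unfolding multipower
  proof (rule ucp_tendsto_step_process)
    show "v n m \<in> borel_measurable M" if "n \<ge> 1" for n m
      using v_int[OF that] by simp
    show "v n m \<omega> \<le> v n m' \<omega>" if "m \<le> m'" for n m m' \<omega>
      unfolding v_def using that by (intro mult_left_mono sum_mono2) (auto simp: G_nonneg)
    show "rho M X k p n \<in> {0..C}" if "n \<ge> 1" for n
      by (rule C[OF that])
    show "(\<lambda>n. prob {\<omega>\<in>space M. \<bar>v n (nat \<lfloor>real n * t\<rfloor>) \<omega> - rho M X k p n * t\<bar> > e}) \<longlonglongrightarrow> 0"
      if "t \<ge> 0" "e > 0" for t e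
      using v_int by (intro prob_abs_gt_tendsto_0 pointwise that Bochner_Integration.integrable_diff) auto
  qed
qed

end
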